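(* Let $R$ be a local principal ideal ring of length two with residue field $k$, let $n\ge1$ and $A\in M_n(k)$. For every $\xi\in \mathrm{Ext}^1_{k[t]}(M^A,M^A)$, $$\bar G_{\mathbf A_\xi}=\mathrm{Stab}_{G_A}\,\xi,$$ where $\bar G_{\mathbf A_\xi}\subseteq G_A$ is the image in $\mathrm{GL}_n(k)$ of the centralizer of $\mathbf A_\xi$ in $\mathrm{GL}_n(R)$.
   Context: $R$ is a commutative local principal ideal ring of length two with maximal ideal $(\pi)$ and residue field $k=R/(\pi)$; $r:M_n(R)\to M_n(k)$ is entrywise reduction. For $\mathbf A\in M_n(R)$, $\mathbf G_{\mathbf A}$ is its centralizer in $\mathrm{GL}_n(R)$ and $\bar G_{\mathbf A}=r(\mathbf G_{\mathbf A})$. For $A\in M_n(k)$, $M^A$ is the $k[t]$-module $k^n$ with $t$ acting by $A$, also viewed as an $R[t]$-module via $R[t]\to k[t]$. For $\mathbf A\in M_n(R)$, $M^{\mathbf A}$ is the $R[t]$-module $R^n$ with $t$ acting by $\mathbf A$. If $r(\mathbf A)=A$, then $\xi_{\mathbf A}\in \mathrm{Ext}^1_{R[t]}(M^A,M^A)$ is the class of $0\to M^A\xrightarrow{\pi}M^{\mathbf A}\to M^A\to 0$, where the first map sends $x$ to $\pi\tilde x$ for any lift $\tilde x\in R^n$ of $x$, and the second is reduction mod $\pi$. $G_A$ is the centralizer of $A$ in $\mathrm{GL}_n(k)$, i.e. $\mathrm{Aut}_{k[t]}(M^A)$. It acts on $\mathrm{Ext}^1(M^A,M^A)$: for classes $\xi$,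 $\xi'$ of $0\to M^A\xrightarrow{i}E\xrightarrow{q}M^A\to0$ and $0\to M^A\xrightarrow{i'}E'\xrightarrow{q'}M^A\to0$, one has $\xi'={}^g\xi$ iff there is a module homomorphism $\phi:E\to E'$ with $\phi i=i'g$ and $q'\phi=gq$. $\iota:\mathrm{Ext}^1_{k[t]}(M^A,M^A)\to\mathrm{Ext}^1_{R[t]}(M^A,M^A)$ is the natural map regarding an extension of $k[t]$-modules as an extension of $R[t]$-modules. Fix a lift $\mathbf A_0\in M_n(R)$ of $A$ such that every $B\in M_n(k)$ commuting with $A$ has a lift $\mathbf B\in M_n(R)$ commuting with $\mathbf A_0$ (such a lift exists). For $\xi\in \mathrm{Ext}^1_{k[t]}(M^A,M^A)$, let $0\to M^A\to E\to M^A\to 0$ be an extension of $R[t]$-modules in the class $\iota(\xi)+\xi_{\mathbf A_0}$. Then $E$ is a free $R$-module of rank $n$, and $\mathbf A_\xi\in M_n(R)$ is the matrix of multiplication by $t$ on $E$ with respect to any $R$-basis of $E$ lifting the standard basis of $M^A$ (defined up to conjugation by $\ker(\mathrm{GL}_n(R)\to\mathrm{GL}_n(k))$, which does not affect $\bar G_{\mathbf A_\xi}$). *)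

theory Defs
  imports
    "HOL-Analysis.Finite_Cartesian_Product"
    "HOL-Algebra.Algebraic_Closure_Type"
    "HOL-Algebra.Module"
    "HOL-Library.Extended_Nat"
begin

section \<open>Local principal ideal rings of length two\<close>

text \<open>The length of a ring as a module over itself: the supremum of the lengths of strict
  chains of ideals.\<close>

definition ring_length :: "('a, 'm) ring_scheme \<Rightarrow> enat" where
  "ring_length R = Sup {enat m | m.
     \<exists>I. (\<forall>j\<le>m. ideal (I j) R) \<and> (\<forall>j<m. I j \<subset> I (Suc j))}"

definition principal_ideal_ring :: "('a, 'm) ring_scheme \<Rightarrow> bool" where
  "principal_ideal_ring R \<longleftrightarrow> cring R \<and> (\<forall>I. ideal I R \<longrightarrow> principalideal I R)"

definition local_ring :: "('a, 'm) ring_scheme \<Rightarrow> bool" where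
  "local_ring R \<longleftrightarrow> cring R \<and> (\<exists>!I. maximalideal I R)"

definition local_pir_length_two :: "'r::comm_ring_1 \<Rightarrow> bool" where
  "local_pir_length_two \<pi> \<longleftrightarrow>
     (let R = (ring_of_type_algebra :: 'r ring) in
       local_ring R \<and> principal_ideal_ring R \<and> ring_length R = 2 \<and> maximalideal (PIdl\<^bsub>R\<^esub> \<pi>) R)"

text \<open>The residue field is any field \<open>'k\<close> together with a surjective ring homomorphism \<open>r\<close>
  whose kernel is the ideal \<open>(\<pi>)\<close>.\<close>

definition residue_map :: "'r::comm_ring_1 \<Rightarrow> ('r \<Rightarrow> 'k::field) \<Rightarrow> bool" where
  "residue_map \<pi> r \<longleftrightarrow>
     (let R = (ring_of_type_algebra :: 'r ring); K = (ring_of_type_algebra :: 'k ring) in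
       r \<in> ring_hom R K \<and> surj r \<and> a_kernel R K r = PIdl\<^bsub>R\<^esub> \<pi>)"

section \<open>Modules\<close>

text \<open>The library's module records extend ring records, but the locale \<open>module\<close> ignores the
  fields \<open>mult\<close> and \<open>one\<close> of the module; they are left undefined throughout.\<close>

definition module_hom_set ::
    "('s, 'x) ring_scheme \<Rightarrow> ('s, 'a) module \<Rightarrow> ('s, 'b) module \<Rightarrow> ('a \<Rightarrow> 'b) set" where
  "module_hom_set S M N = {h \<in> hom (add_monoid M) (add_monoid N).
     \<forall>s\<in>carrier S. \<forall>x\<in>carrier M. h (s \<odot>\<^bsub>M\<^esub> x) = s \<odot>\<^bsub>N\<^esub> h x}"

definition quotient_module :: "('s, 'a) module \<Rightarrow> 'a set \<Rightarrow> ('s, 'a set) module" where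
  "quotient_module M D =
     \<lparr>carrier = a_rcosets\<^bsub>M\<^esub> D, monoid.mult = undefined, one = undefined,
      ring.zero = D, add = (\<lambda>C C'. C <+>\<^bsub>M\<^esub> C'),
      module.smult = (\<lambda>s C. \<Union>x\<in>C. D +>\<^bsub>M\<^esub> (s \<odot>\<^bsub>M\<^esub> x))\<rparr>"

definition pullback_module ::
    "('s, 'a) module \<Rightarrow> ('a \<Rightarrow> 'c) \<Rightarrow> ('s, 'b) module \<Rightarrow> ('b \<Rightarrow> 'c) \<Rightarrow> ('s, 'a \<times> 'b) module" where
  "pullback_module M f N g =
     \<lparr>carrier = {(x, y). x \<in> carrier M \<and> y \<in> carrier N \<and> f x = g y},
      monoid.mult = undefined, one = undefined,
      ring.zero = (\<zero>\<^bsub>M\<^esub>, \<zero>\<^bsub>N\<^esub>),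
      add = (\<lambda>(x, y) (x', y'). (x \<oplus>\<^bsub>M\<^esub> x', y \<oplus>\<^bsub>N\<^esub> y')),
      module.smult = (\<lambda>s (x, y). (s \<odot>\<^bsub>M\<^esub> x, s \<odot>\<^bsub>N\<^esub> y))\<rparr>"

text \<open>Restriction of scalars along the map of polynomial rings induced by \<open>r\<close>.\<close>

definition restrict_scalars ::
    "('r::zero \<Rightarrow> 'k::zero) \<Rightarrow> ('k poly, 'a) module \<Rightarrow> ('r poly, 'a) module" where
  "restrict_scalars r M =
     \<lparr>carrier = carrier M, monoid.mult = monoid.mult M, one = one M,
      ring.zero = ring.zero M, add = add M,
      module.smult = (\<lambda>p x. map_poly r p \<odot>\<^bsub>M\<^esub> x)\<rparr>"

text \<open>The module of column vectors over a polynomial ring, with the variable acting as the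
  matrix \<open>A\<close>.\<close>

definition matrix_module :: "'a::comm_ring_1 ^ 'n ^ 'n \<Rightarrow> ('a poly, 'a ^ 'n) module" where
  "matrix_module A =
     \<lparr>carrier = UNIV, monoid.mult = undefined, one = undefined, ring.zero = 0, add = (+),
      module.smult =
        (\<lambda>p v. \<Sum>i\<le>Polynomial.degree p. Polynomial.coeff p i *s (((*v) A ^^ i) v))\<rparr>"

section \<open>Extensions and their classes\<close>

text \<open>A triple \<open>(E, i, q)\<close> stands for \<open>0 \<rightarrow> M \<rightarrow> E \<rightarrow> N \<rightarrow> 0\<close> with first map \<open>i\<close>
  and second map \<open>q\<close>. The values of \<open>i\<close> and \<open>q\<close> outside the carriers play no role.\<close>

type_synonym ('s, 'a, 'e, 'b) extn = "('s, 'e) module \<times> ('a \<Rightarrow> 'e) \<times> ('e \<Rightarrow> 'b)"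

definition is_extension ::
    "('s, 'x) ring_scheme \<Rightarrow> ('s, 'b) module \<Rightarrow> ('s, 'a) module \<Rightarrow> ('s, 'a, 'e, 'b) extn \<Rightarrow> bool"
  where
  "is_extension S N M = (\<lambda>(E, i, q).
     Module.module S E \<and> i \<in> module_hom_set S M E \<and> q \<in> module_hom_set S E N \<and>
     inj_on i (carrier M) \<and> i ` carrier M = {x \<in> carrier E. q x = \<zero>\<^bsub>N\<^esub>} \<and>
     q ` carrier E = carrier N)"

text \<open>A morphism of extensions inducing \<open>f\<close> on the submodule and \<open>g\<close> on the quotient. The two
  middle modules may live on different types.\<close>

definition extension_morphism ::
    "('s, 'x) ring_scheme \<Rightarrow> ('s, 'a) module \<Rightarrow> ('a \<Rightarrow> 'a) \<Rightarrow> ('b \<Rightarrow> 'b) \<Rightarrow>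
     ('s, 'a, 'e, 'b) extn \<Rightarrow> ('s, 'a, 'f, 'b) extn \<Rightarrow> ('e \<Rightarrow> 'f) \<Rightarrow> bool" where
  "extension_morphism S M f g = (\<lambda>(E, i, q) (E', i', q') \<phi>.
     \<phi> \<in> module_hom_set S E E' \<and>
     (\<forall>a\<in>carrier M. \<phi> (i a) = i' (f a)) \<and> (\<forall>x\<in>carrier E. q' (\<phi> x) = g (q x)))"

definition extension_equiv ::
    "('s, 'x) ring_scheme \<Rightarrow> ('s, 'a) module \<Rightarrow>
     ('s, 'a, 'e, 'b) extn \<Rightarrow> ('s, 'a, 'f, 'b) extn \<Rightarrow> bool" where
  "extension_equiv S M \<E> \<F> \<longleftrightarrow> (\<exists>\<phi>. extension_morphism S M (\<lambda>a. a) (\<lambda>b. b) \<E> \<F> \<phi>)"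

text \<open>\<open>Ext1 S N M\<close> is the set of classes of extensions of \<open>N\<close> by \<open>M\<close> whose middle module has
  its carrier in the type \<open>'e\<close>. The middle module of any extension is in bijection with
  \<open>carrier M \<times> carrier N\<close>: if \<open>'e\<close> is at least that large, every extension is represented, and
  otherwise \<open>Ext1 S N M\<close> is empty. A statement about all \<open>\<xi> \<in> Ext1 S N M\<close> for arbitrary \<open>'e\<close> thus
  concerns all extension classes.\<close>

definition Ext1 ::
    "('s, 'x) ring_scheme \<Rightarrow> ('s, 'b) module \<Rightarrow> ('s, 'a) module \<Rightarrow> ('s, 'a, 'e, 'b) extn set set"
  where
  "Ext1 S N M = {\<E>. is_extension S N M \<E>} //
     {(\<E>, \<F>). is_extension S N M \<E> \<and> is_extension S N M \<F> \<and> extension_equiv S M \<E> \<F>}"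

definition extension_class ::
    "('s, 'x) ring_scheme \<Rightarrow> ('s, 'b) module \<Rightarrow> ('s, 'a) module \<Rightarrow>
     ('s, 'a, 'f, 'b) extn \<Rightarrow> ('s, 'a, 'e, 'b) extn set" where
  "extension_class S N M \<E> = {\<F>. is_extension S N M \<F> \<and> extension_equiv S M \<E> \<F>}"

text \<open>The quotient of the pullback of the two middle modules over \<open>N\<close> by the
  antidiagonal copy of \<open>M\<close>. The map \<open>(x, y) \<mapsto> q x\<close> is constant on each coset.\<close>

definition baer_sum ::
    "('s, 'a) module \<Rightarrow>
     ('s, 'a, 'e, 'b) extn \<Rightarrow> ('s, 'a, 'f, 'b) extn \<Rightarrow> ('s, 'a, ('e \<times> 'f) set, 'b) extn" where
  "baer_sum M = (\<lambda>(E, i, q) (E', i', q').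
     let P = pullback_module E q E' q';
         D = {(i a, \<ominus>\<^bsub>E'\<^esub> i' a) | a. a \<in> carrier M}
     in (quotient_module P D,
         (\<lambda>a. D +>\<^bsub>P\<^esub> (i a, \<zero>\<^bsub>E'\<^esub>)),
         (\<lambda>C. the_elem ((q \<circ> fst) ` C))))"

definition Ext1_add ::
    "('s, 'x) ring_scheme \<Rightarrow> ('s, 'b) module \<Rightarrow> ('s, 'a) module \<Rightarrow>
     ('s, 'a, 'e, 'b) extn set \<Rightarrow> ('s, 'a, 'e, 'b) extn set \<Rightarrow> ('s, 'a, 'e, 'b) extn set" where
  "Ext1_add S N M \<xi> \<eta> = (\<Union>\<E>\<in>\<xi>. \<Union>\<F>\<in>\<eta>. extension_class S N M (baer_sum M \<E> \<F>))"

text \<open>For an automorphism \<open>g\<close> of \<open>M\<close>, the class of the extensions \<open>\<F>\<close> of \<open>M\<close> by itself that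
  receive from a member of \<open>\<xi>\<close> a morphism inducing \<open>g\<close> on both ends.\<close>

definition Ext1_act ::
    "('s, 'x) ring_scheme \<Rightarrow> ('s, 'a) module \<Rightarrow> ('a \<Rightarrow> 'a) \<Rightarrow>
     ('s, 'a, 'e, 'a) extn set \<Rightarrow> ('s, 'a, 'e, 'a) extn set" where
  "Ext1_act S M g \<xi> =
     {\<F>. is_extension S M M \<F> \<and> (\<exists>\<E>\<in>\<xi>. \<exists>\<phi>. extension_morphism S M g g \<E> \<F> \<phi>)}"

definition Ext1_restrict ::
    "('r::comm_ring_1 \<Rightarrow> 'k::comm_ring_1) \<Rightarrow> ('k poly, 'b) module \<Rightarrow> ('k poly, 'a) module \<Rightarrow>
     ('k poly, 'a, 'e, 'b) extn set \<Rightarrow> ('r poly, 'a, 'e, 'b) extn set" where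
  "Ext1_restrict r N M \<xi> = (\<Union>(E, i, q)\<in>\<xi>.
     extension_class ring_of_type_algebra (restrict_scalars r N) (restrict_scalars r M)
       (restrict_scalars r E, i, q))"

section \<open>Matrices and their lifts\<close>

definition GL_centralizer :: "'a::comm_ring_1 ^ 'n ^ 'n \<Rightarrow> ('a ^ 'n ^ 'n) set" where
  "GL_centralizer A = {g. invertible g \<and> g ** A = A ** g}"

text \<open>The extension \<open>0 \<rightarrow> M\<^sup>A \<rightarrow> M\<^sup>B \<rightarrow> M\<^sup>A \<rightarrow> 0\<close> attached to a lift \<open>B\<close> of \<open>A\<close>: the second map is
  reduction, the first one is multiplication by \<open>\<pi>\<close> of an arbitrary lift. The chosen lift is
  irrelevant, since two lifts differ by a multiple of \<open>\<pi>\<close> and \<open>\<pi>\<^sup>2 = 0\<close>.\<close>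

definition lift_extension ::
    "'r::comm_ring_1 \<Rightarrow> ('r \<Rightarrow> 'k::field) \<Rightarrow> 'r ^ 'n ^ 'n \<Rightarrow> ('r poly, 'k ^ 'n, 'r ^ 'n, 'k ^ 'n) extn"
  where
  "lift_extension \<pi> r B =
     (matrix_module B,
      (\<lambda>x. \<pi> *s (SOME y. (\<chi> j. r (y $ j)) = x)),
      (\<lambda>y. \<chi> j. r (y $ j)))"

definition lift_class ::
    "'r::comm_ring_1 \<Rightarrow> ('r \<Rightarrow> 'k::field) \<Rightarrow> 'k ^ 'n ^ 'n \<Rightarrow> 'r ^ 'n ^ 'n \<Rightarrow>
     ('r poly, 'k ^ 'n, 'e, 'k ^ 'n) extn set" where
  "lift_class \<pi> r A B =
     extension_class ring_of_type_algebra
       (restrict_scalars r (matrix_module A)) (restrict_scalars r (matrix_module A))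
       (lift_extension \<pi> r B)"

text \<open>\<open>e\<close> is a basis of \<open>E\<close> over the coefficient ring \<open>'r\<close>, which acts through the constant
  polynomials.\<close>

definition coefficient_basis ::
    "('r::comm_ring_1 poly, 'e) module \<Rightarrow> ('n::finite \<Rightarrow> 'e) \<Rightarrow> bool" where
  "coefficient_basis E e \<longleftrightarrow> range e \<subseteq> carrier E \<and>
     bij_betw (\<lambda>c :: 'r ^ 'n. \<Oplus>\<^bsub>E\<^esub>j\<in>UNIV. [:c $ j:] \<odot>\<^bsub>E\<^esub> e j) UNIV (carrier E)"

text \<open>\<open>B\<close> is the matrix of multiplication by the variable \<open>[:0, 1:]\<close> in the basis \<open>e\<close>.\<close>

definition variable_matrix ::
    "('r::comm_ring_1 poly, 'e) module \<Rightarrow> ('n::finite \<Rightarrow> 'e) \<Rightarrow> 'r ^ 'n ^ 'n \<Rightarrow> bool" where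
  "variable_matrix E e B \<longleftrightarrow>
     (\<forall>j. [:0, 1:] \<odot>\<^bsub>E\<^esub> e j = (\<Oplus>\<^bsub>E\<^esub>i\<in>UNIV. [:B $ i $ j:] \<odot>\<^bsub>E\<^esub> e i))"

end

theory Submission
  imports Defs
begin

text \<open>
  Both sides of the equality are described by one linear equation over the residue field.

  As a vector space, an extension of \<open>M\<^sup>A\<close> by itself over the polynomial ring of \<open>'k\<close> splits. A linear
  section \<open>s\<close> of its projection therefore encodes it by the matrix \<open>C\<close> that measures the failure of
  \<open>s\<close> to commute with the variable \<open>t\<close>: \<open>t (s x) = C x + s (A x)\<close>. An endomorphism of the extension
  that restricts to \<open>g\<close> on the submodule and induces \<open>g\<close> on the quotient sends \<open>s x\<close> to
  \<open>Y x + s (g x)\<close> for some matrix \<open>Y\<close>, and it commutes with \<open>t\<close> exactly if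
  \<open>g C + Y A = A Y + C g\<close>. Since morphisms of extensions over automorphisms are invertible, \<open>g\<close>
  stabilizes the class if and only if such an endomorphism exists
  (\<open>Ext1_act_fixes_iff\<close>, \<open>self_morphism_iff\<close>), hence if and only if the equation has a solution \<open>Y\<close>.

  On the other side, adding the class of \<open>C\<close> to that of the lift \<open>A0\<close> replaces \<open>A0\<close> by
  \<open>A0 + \<pi> C'\<close>, where \<open>C'\<close> lifts \<open>C\<close>. More precisely, every basis that lifts the standard basis
  determines a section \<open>s\<close> for which the matrix of \<open>t\<close> is equal, not merely conjugate, to
  \<open>A0 + \<pi> C'\<close> (\<open>variable_matrix_perturbation\<close>). A matrix \<open>g\<close> that commutes with \<open>A\<close> has a lift \<open>G0\<close>
  that commutes with \<open>A0\<close>, so all its lifts have the form \<open>G0 + \<pi> Y'\<close>. As \<open>\<pi>\<^sup>2 = 0\<close>, the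
  condition that \<open>G0 + \<pi> Y'\<close> commutes with \<open>A0 + \<pi> C'\<close> only has a first-order term; as \<open>\<pi> a\<close>
  depends on the residue of \<open>a\<close> and determines it, this term is again
  \<open>g C + Y A = A Y + C g\<close>, with \<open>Y\<close> the reduction of \<open>Y'\<close> (\<open>red_GL_centralizer\<close>).
\<close>

section \<open>Rings of length two\<close>

lemma ring_of_type_algebra_simps [simp]:
  "carrier ring_of_type_algebra = UNIV"
  "x \<otimes>\<^bsub>ring_of_type_algebra\<^esub> y = x * y"
  "x \<oplus>\<^bsub>ring_of_type_algebra\<^esub> y = x + y"
  "\<one>\<^bsub>ring_of_type_algebra\<^esub> = 1"
  "\<zero>\<^bsub>ring_of_type_algebra\<^esub> = 0"
  by (simp_all add: ring_of_type_algebra_def)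

lemma PIdl_of_type: "PIdl\<^bsub>ring_of_type_algebra\<^esub> a = {b * a | b. True}"
  by (simp add: cgenideal_def)

lemma ideal_PIdl_of_type: "ideal (PIdl\<^bsub>ring_of_type_algebra\<^esub> (a :: 'r::comm_ring_1)) ring_of_type_algebra"
  by (rule cring.cgenideal_ideal[OF cring_from_type_algebra]) simp

lemma ideal_zero_of_type: "ideal {0 :: 'r::comm_ring_1} ring_of_type_algebra"
  using ideal_PIdl_of_type[of "0::'r"] by (simp add: PIdl_of_type)

lemma ideal_UNIV_of_type: "ideal (UNIV :: 'r::comm_ring_1 set) ring_of_type_algebra"
  using ideal_PIdl_of_type[of "1::'r"] by (simp add: PIdl_of_type)

lemma ring_length_two_no_longer_chain:
  assumes len: "ring_length (ring_of_type_algebra :: 'r::comm_ring_1 ring) = 2"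
    and I: "ideal I (ring_of_type_algebra :: 'r ring)" and J: "ideal J (ring_of_type_algebra :: 'r ring)"
    and ch: "{0} \<subset> I" "I \<subset> J" "J \<subset> UNIV"
  shows False
proof -
  let ?R = "ring_of_type_algebra :: 'r ring"
  define C where "C = (\<lambda>j::nat. if j = 0 then {0} else if j = 1 then I else if j = 2 then J else UNIV)"
  have "(\<forall>j\<le>3. ideal (C j) ?R) \<and> (\<forall>j<3. C j \<subset> C (Suc j))"
    using I J ch ideal_zero_of_type ideal_UNIV_of_type by (auto simp: C_def less_Suc_eq numeral_3_eq_3)
  then have "enat 3 \<le> ring_length ?R"
    unfolding ring_length_def by (intro Sup_upper) blast
  then show False
    by (simp add: len numeral_eq_enat)
qed

lemma ring_length_two_chain:
  assumes len: "ring_length (ring_of_type_algebra :: 'r::comm_ring_1 ring) = 2"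
  obtains I J K where "ideal I (ring_of_type_algebra :: 'r ring)"
    "ideal J (ring_of_type_algebra :: 'r ring)" "ideal K (ring_of_type_algebra :: 'r ring)" "I \<subset> J" "J \<subset> K"
proof -
  let ?R = "ring_of_type_algebra :: 'r ring"
  have "\<not> ring_length ?R \<le> enat 1"
    by (simp add: len numeral_eq_enat)
  then obtain m C where C: "\<forall>j\<le>m. ideal (C j) ?R" "\<forall>j<m. C j \<subset> C (Suc j)" "\<not> enat m \<le> enat 1"
    unfolding ring_length_def Sup_le_iff by blast
  then have "2 \<le> m" by simp
  with C that[of "C 0" "C 1" "C 2"] show ?thesis
    by (metis One_nat_def Suc_1 Suc_leD Suc_le_lessD zero_le less_eq_nat.simps(1))
qed

text \<open>What the proof uses of a local principal ideal ring of length two. The last two axioms say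
  that \<open>\<pi>\<close> generates the maximal ideal and that its annihilator is again this ideal: multiplication
  by \<open>\<pi>\<close> identifies the residue field with the maximal ideal.\<close>

locale length_two_reduction =
  fixes \<pi> :: "'r::comm_ring_1" and r :: "'r \<Rightarrow> 'k::field"
  assumes red_add: "r (a + b) = r a + r b"
    and red_mult: "r (a * b) = r a * r b"
    and red_one: "r 1 = 1"
    and red_surj: "surj r"
    and red_eq_0_iff: "r a = 0 \<longleftrightarrow> (\<exists>b. a = \<pi> * b)"
    and pi_mult_eq_0_iff: "\<pi> * a = 0 \<longleftrightarrow> r a = 0"

text \<open>The hypothesis on the length enters twice. If \<open>\<pi>\<close> were zero, the only ideals would be the zero
  ideal and the whole ring, and there would be no chain of length two. If \<open>\<pi>\<^sup>2\<close> were nonzero, the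
  ideal \<open>(\<pi>\<^sup>2)\<close> could not be smaller than \<open>(\<pi>)\<close>, and their equality contradicts locality. That \<open>\<pi> a = 0\<close> forces
  \<open>r a = 0\<close> holds because an element with nonzero residue is invertible up to a multiple of \<open>\<pi>\<close>.\<close>

lemma length_two_reductionI:
  fixes \<pi> :: "'r::comm_ring_1" and r :: "'r \<Rightarrow> 'k::field"
  assumes loc: "local_pir_length_two \<pi>" and res: "residue_map \<pi> r"
  shows "length_two_reduction \<pi> r"
proof -
  let ?R = "ring_of_type_algebra :: 'r ring"
  let ?K = "ring_of_type_algebra :: 'k ring"
  have len: "ring_length ?R = 2" and mx: "maximalideal (PIdl\<^bsub>?R\<^esub> \<pi>) ?R"
    and uniq: "\<exists>!I. maximalideal I ?R"
    using loc by (auto simp: local_pir_length_two_def Let_def local_ring_def)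
  have hom: "r \<in> ring_hom ?R ?K" and sur: "surj r" and ker: "a_kernel ?R ?K r = PIdl\<^bsub>?R\<^esub> \<pi>"
    using res by (auto simp: residue_map_def Let_def)
  have add: "r (a + b) = r a + r b" and mult: "r (a * b) = r a * r b" and one: "r 1 = 1" for a b
    using hom by (auto simp: ring_hom_def)
  have eq0: "r a = 0 \<longleftrightarrow> (\<exists>b. a = \<pi> * b)" for a
  proof -
    have "a \<in> a_kernel ?R ?K r \<longleftrightarrow> a \<in> PIdl\<^bsub>?R\<^esub> \<pi>" using ker by simp
    then show ?thesis by (auto simp: a_kernel_def kernel_def PIdl_of_type mult.commute)
  qed
  interpret m: maximalideal "PIdl\<^bsub>?R\<^esub> \<pi>" ?R by (rule mx)
  have rzero: "r 0 = 0" by (metis add add_cancel_right_right add.right_neutral)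
  have rpi: "r \<pi> = 0" using eq0[of \<pi>] by (metis mult_1_right)
  have pi0: "\<pi> \<noteq> 0"
  proof
    assume "\<pi> = 0"
    then have z: "PIdl\<^bsub>?R\<^esub> \<pi> = {0}" by (auto simp: PIdl_of_type)
    obtain I J K where IJK: "ideal I ?R" "ideal J ?R" "ideal K ?R" "I \<subset> J" "J \<subset> K"
      using ring_length_two_chain[OF len] by blast
    have "0 \<in> L" if "ideal L ?R" for L :: "'r set"
      using that additive_subgroup.zero_closed[OF ideal.axioms(1)] by force
    then have "J = {0} \<or> J = UNIV" "0 \<in> I"
      using m.I_maximal[of J] IJK by (auto simp: z)
    then show False using IJK by auto
  qed
  \<comment> \<open>If \<open>\<pi>\<^sup>2\<close> were nonzero, then \<open>(\<pi>\<^sup>2) = (\<pi>)\<close> by the length, say \<open>\<pi> = u \<pi>\<^sup>2\<close>. Now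
    \<open>a = 1 - \<pi> u\<close> is killed by \<open>\<pi>\<close>, so it generates a proper nonzero ideal, which is maximal by
    the length and equal to \<open>(\<pi>)\<close> by locality, although \<open>a\<close> has residue \<open>1\<close>.\<close>
  have sq: "\<pi> * \<pi> = 0"
  proof (rule ccontr)
    assume nz: "\<pi> * \<pi> \<noteq> 0"
    let ?I = "PIdl\<^bsub>?R\<^esub> (\<pi> * \<pi>)" and ?J = "PIdl\<^bsub>?R\<^esub> \<pi>"
    have "{0} \<subset> ?I"
    proof -
      have "\<pi> * \<pi> \<in> ?I" unfolding PIdl_of_type by (metis (mono_tags, lifting) mem_Collect_eq mult_1)
      moreover have "0 \<in> ?I" unfolding PIdl_of_type by (metis (mono_tags, lifting) mem_Collect_eq mult_zero_left)
      ultimately show ?thesis using nz by auto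
    qed
    moreover have "?I \<subseteq> ?J"
      by (auto simp: PIdl_of_type) (metis mult.assoc)
    moreover have "?J \<subset> UNIV" using m.I_notcarr by auto
    ultimately have "?I = ?J"
      using ring_length_two_no_longer_chain[OF len, of ?I ?J] ideal_PIdl_of_type by blast
    moreover have "\<pi> \<in> ?J" unfolding PIdl_of_type by (metis (mono_tags, lifting) mem_Collect_eq mult_1)
    ultimately obtain u where u: "\<pi> = u * (\<pi> * \<pi>)" by (auto simp: PIdl_of_type)
    define a where "a = 1 - \<pi> * u"
    have pa: "\<pi> * a = 0" using u by (simp add: a_def algebra_simps)
    have "r (a + \<pi> * u) = 1" by (simp add: a_def one)
    then have ra: "r a = 1" by (simp add: add mult rpi)
    let ?A = "PIdl\<^bsub>?R\<^esub> a"
    have aA: "a \<in> ?A" unfolding PIdl_of_type by (metis (mono_tags, lifting) mem_Collect_eq mult_1)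
    have az: "a \<noteq> 0" using ra rzero by auto
    have A_ne: "?A \<noteq> UNIV"
    proof
      assume "?A = UNIV"
      then have "1 \<in> ?A" by simp
      then obtain b where "1 = b * a" by (auto simp: PIdl_of_type)
      then have "\<pi> = \<pi> * a * b" by (metis mult.assoc mult.commute mult_1_right)
      with pa pi0 show False by simp
    qed
    have "maximalideal ?A ?R"
    proof (rule maximalidealI)
      show "ideal ?A ?R" by (rule ideal_PIdl_of_type)
      show "carrier ?R \<noteq> ?A" using A_ne by simp
      fix J assume J: "ideal J ?R" "?A \<subseteq> J" "J \<subseteq> carrier ?R"
      have "0 \<in> ?A" unfolding PIdl_of_type by (metis (mono_tags, lifting) mem_Collect_eq mult_zero_left)
      with aA az have "{0} \<subset> ?A" by auto
      with J show "J = ?A \<or> J = carrier ?R"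
        using ring_length_two_no_longer_chain[OF len ideal_PIdl_of_type J(1)] by auto
    qed
    with uniq mx have "?A = ?J" by blast
    with aA obtain b where "a = b * \<pi>" by (auto simp: PIdl_of_type)
    then show False using ra by (simp add: mult rpi)
  qed
  have ann: "\<pi> * a = 0 \<longleftrightarrow> r a = 0" for a
  proof
    assume "r a = 0"
    then show "\<pi> * a = 0" using sq by (auto simp: eq0 mult.assoc[symmetric])
  next
    assume pa: "\<pi> * a = 0"
    show "r a = 0"
    proof (rule ccontr)
      assume "r a \<noteq> 0"
      moreover obtain b where "r b = inverse (r a)" using sur by (metis surjD)
      ultimately have "r (a * b) = 1" by (simp add: mult)
      then have "r (a * b + (- 1)) = 0"
        using add[of 1 "-1"] add[of "a * b" "-1"] by (simp add: one rzero)
      then obtain c where "a * b - 1 = \<pi> * c" by (auto simp: eq0)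
      then have "1 = a * b - \<pi> * c" by (simp add: algebra_simps)
      then have "\<pi> = \<pi> * a * b - \<pi> * \<pi> * c" by (metis mult.assoc mult_1_right right_diff_distrib)
      then show False using pa sq pi0 by simp
    qed
  qed
  show ?thesis
    by unfold_locales (use add mult one sur eq0 ann in auto)
qed

section \<open>Lifting matrices and their centralizers\<close>

definition map_vector :: "('a \<Rightarrow> 'b) \<Rightarrow> 'a ^ 'n \<Rightarrow> 'b ^ 'n" where
  "map_vector f x = (\<chi> j. f (x $ j))"

lemma map_vector_nth [simp]: "map_vector f x $ j = f (x $ j)"
  by (simp add: map_vector_def)

lemma matrix_add_rdistrib: "(A + B) ** C = A ** C + B ** (C :: 'a::semiring_1 ^ 'm ^ 'n)"
  by (simp add: vec_eq_iff matrix_matrix_mult_def sum.distrib algebra_simps)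

lemma matrix_vector_mult_smult: "B *v (c *s x) = (c :: 'a::comm_ring_1) *s (B *v x)"
  by (simp add: vec_eq_iff matrix_vector_mult_def sum_distrib_left mult_ac)

lemma map_matrix_smult_mult:
  fixes c :: "'a::comm_ring_1"
  shows "map_matrix ((*) c) A ** B = map_matrix ((*) c) (A ** B)"
    and "A ** map_matrix ((*) c) B = map_matrix ((*) c) (A ** B)"
  by (simp_all add: vec_eq_iff matrix_matrix_mult_def sum_distrib_left mult_ac)

lemma map_matrix_smult_add:
  fixes c :: "'a::comm_ring_1"
  shows "map_matrix ((*) c) (A + B) = map_matrix ((*) c) A + map_matrix ((*) c) B"
  by (simp add: vec_eq_iff algebra_simps)

lemma map_matrix_smult_vector:
  fixes c :: "'a::comm_ring_1"
  shows "map_matrix ((*) c) A *v x = c *s (A *v x)"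
  by (simp add: vec_eq_iff matrix_vector_mult_def sum_distrib_left mult_ac)

context length_two_reduction
begin

lemma red_zero [simp]: "r 0 = 0"
  by (metis red_add add_cancel_right_right add.right_neutral)

lemma red_pi [simp]: "r \<pi> = 0"
  using red_eq_0_iff by (metis mult_1_right)

lemma pi_square [simp]: "\<pi> * \<pi> = 0"
  by (simp add: pi_mult_eq_0_iff)

lemma red_uminus: "r (- a) = - r a"
  by (metis red_add red_zero add.right_inverse add_eq_0_iff)

lemma red_diff: "r (a - b) = r a - r b"
  using red_add[of a "- b"] by (simp add: red_uminus)

lemma red_sum: "r (sum f I) = (\<Sum>i\<in>I. r (f i))"
  by (induction I rule: infinite_finite_induct) (simp_all add: red_add)

lemma pi_mult_cancel: "\<pi> * a = \<pi> * b \<longleftrightarrow> r a = r b"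
  using pi_mult_eq_0_iff[of "a - b"] by (simp add: red_diff algebra_simps)

lemma red_matrix_mult: "map_matrix r (A ** B) = map_matrix r A ** map_matrix r B"
  by (simp add: vec_eq_iff matrix_matrix_mult_def red_sum red_mult)

lemma red_matrix_add: "map_matrix r (A + B) = map_matrix r A + map_matrix r B"
  by (simp add: vec_eq_iff red_add)

lemma red_matrix_one: "map_matrix r (mat 1) = mat 1"
  by (simp add: vec_eq_iff mat_def red_one)

lemma red_matrix_pi [simp]: "map_matrix r (map_matrix ((*) \<pi>) A) = 0"
  by (simp add: vec_eq_iff red_mult)

lemma red_matrix_surj: obtains B where "map_matrix r B = A"
proof
  show "map_matrix r (map_matrix (inv_into UNIV r) A) = A"
    by (simp add: vec_eq_iff surj_f_inv_f[OF red_surj])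
qed

lemma red_matrix_eqE:
  assumes "map_matrix r A = map_matrix r B"
  obtains Y where "A = B + map_matrix ((*) \<pi>) Y"
proof -
  have "\<exists>b. A $ i $ j - B $ i $ j = \<pi> * b" for i j
    using assms by (auto simp: red_eq_0_iff[symmetric] red_diff vec_eq_iff)
  then obtain b where "\<And>i j. A $ i $ j - B $ i $ j = \<pi> * b i j" by metis
  then have "A = B + map_matrix ((*) \<pi>) (\<chi> i j. b i j)"
    by (simp add: vec_eq_iff) (metis add.commute diff_add_cancel)
  then show ?thesis by (rule that)
qed

lemma pi_matrix_cancel:
  "map_matrix ((*) \<pi>) A = map_matrix ((*) \<pi>) B \<longleftrightarrow> map_matrix r A = map_matrix r B"
  by (simp add: vec_eq_iff pi_mult_cancel)

lemma pi_matrix_pi [simp]: "map_matrix ((*) \<pi>) (map_matrix ((*) \<pi>) A) = 0"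
  by (simp add: vec_eq_iff mult.assoc[symmetric])

lemma red_vector_add: "map_vector r (x + y) = map_vector r x + map_vector r y"
  by (simp add: vec_eq_iff red_add)

lemma red_vector_smult: "map_vector r (c *s y) = r c *s map_vector r y"
  by (simp add: vec_eq_iff red_mult)

lemma red_vector_mult: "map_vector r (A *v y) = map_matrix r A *v map_vector r y"
  by (simp add: vec_eq_iff matrix_vector_mult_def red_sum red_mult)

lemma red_vector_surj: obtains y where "map_vector r y = x"
proof
  show "map_vector r (map_vector (inv_into UNIV r) x) = x"
    by (simp add: vec_eq_iff surj_f_inv_f[OF red_surj])
qed

lemma red_vector_eqE:
  assumes "map_vector r x = map_vector r y"
  obtains z where "x = y + \<pi> *s z"
proof -
  have "\<exists>b. x $ i - y $ i = \<pi> * b" for i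
    using assms by (auto simp: red_eq_0_iff[symmetric] red_diff vec_eq_iff)
  then obtain b where "\<And>i. x $ i - y $ i = \<pi> * b i" by metis
  then have "x = y + \<pi> *s (\<chi> i. b i)"
    by (simp add: vec_eq_iff) (metis add.commute diff_add_cancel)
  then show ?thesis by (rule that)
qed

lemma pi_vector_cancel: "\<pi> *s x = \<pi> *s y \<longleftrightarrow> map_vector r x = map_vector r y"
  by (simp add: vec_eq_iff pi_mult_cancel)

lemma pi_pi_mult [simp]: "\<pi> * (\<pi> * a) = 0"
  by (simp add: mult.assoc[symmetric])

text \<open>Invertibility lifts along the reduction: a product of lifts of mutually inverse matrices is
  the identity plus a multiple of \<open>\<pi>\<close>, and such a matrix is inverted explicitly because \<open>\<pi>\<^sup>2 = 0\<close>.\<close>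

lemma unipotent_inverse: "(mat 1 + map_matrix ((*) \<pi>) Y) ** (mat 1 + map_matrix ((*) \<pi>) (- Y)) = mat 1"
  by (simp add: matrix_add_ldistrib matrix_add_rdistrib map_matrix_smult_mult vec_eq_iff right_diff_distrib)

lemma invertible_lift:
  assumes "invertible (map_matrix r G)"
  shows "invertible G"
proof -
  obtain h where h: "map_matrix r G ** h = mat 1" "h ** map_matrix r G = mat 1"
    using assms by (auto simp: invertible_def)
  obtain H where H: "map_matrix r H = h" by (rule red_matrix_surj)
  obtain Y where Y: "G ** H = mat 1 + map_matrix ((*) \<pi>) Y"
    using red_matrix_eqE[of "G ** H" "mat 1"] h by (auto simp: red_matrix_mult red_matrix_one H)
  obtain Z where Z: "H ** G = mat 1 + map_matrix ((*) \<pi>) Z"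
    using red_matrix_eqE[of "H ** G" "mat 1"] h by (auto simp: red_matrix_mult red_matrix_one H)
  have R: "G ** (H ** (mat 1 + map_matrix ((*) \<pi>) (- Y))) = mat 1"
    using unipotent_inverse[of Y] by (simp add: matrix_mul_assoc Y)
  have "(mat 1 + map_matrix ((*) \<pi>) (- Z)) ** (H ** G) = mat 1"
    using unipotent_inverse[of "- Z"] by (simp add: Z)
  then have L: "((mat 1 + map_matrix ((*) \<pi>) (- Z)) ** H) ** G = mat 1"
    by (simp add: matrix_mul_assoc)
  let ?U = "(mat 1 + map_matrix ((*) \<pi>) (- Z)) ** H" and ?V = "H ** (mat 1 + map_matrix ((*) \<pi>) (- Y))"
  have "?U = ?U ** (G ** ?V)" by (simp add: R)
  also have "\<dots> = (?U ** G) ** ?V" by (rule matrix_mul_assoc)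
  finally have "?U = ?V" by (simp add: L)
  with L R show ?thesis unfolding invertible_def by metis
qed

lemma invertible_red:
  assumes "invertible G"
  shows "invertible (map_matrix r G)"
  using assms unfolding invertible_def by (metis red_matrix_mult red_matrix_one)

text \<open>The products agree in the constant term by assumption, and their quadratic terms vanish with
  \<open>\<pi>\<^sup>2\<close>. Only the linear terms remain, and these matter only modulo \<open>\<pi>\<close>.\<close>

lemma commute_first_order_iff:
  assumes "G0 ** A0 = A0 ** G0"
  shows "(G0 + map_matrix ((*) \<pi>) Y) ** (A0 + map_matrix ((*) \<pi>) C) =
      (A0 + map_matrix ((*) \<pi>) C) ** (G0 + map_matrix ((*) \<pi>) Y) \<longleftrightarrow>
    map_matrix r G0 ** map_matrix r C + map_matrix r Y ** map_matrix r A0 =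
      map_matrix r A0 ** map_matrix r Y + map_matrix r C ** map_matrix r G0"
    (is "?l = ?r \<longleftrightarrow> ?eq")
proof -
  have "?l = G0 ** A0 + map_matrix ((*) \<pi>) (G0 ** C + Y ** A0)"
    by (simp add: matrix_add_ldistrib matrix_add_rdistrib map_matrix_smult_mult
        map_matrix_smult_add add_ac)
  moreover have "?r = G0 ** A0 + map_matrix ((*) \<pi>) (A0 ** Y + C ** G0)"
    by (simp add: matrix_add_ldistrib matrix_add_rdistrib map_matrix_smult_mult
        map_matrix_smult_add add_ac assms)
  ultimately show ?thesis
    by (simp add: pi_matrix_cancel red_matrix_add red_matrix_mult)
qed

text \<open>Thanks to the assumption on \<open>A0\<close>, every lift of \<open>g\<close> differs by some \<open>\<pi> Y\<close> from one that
  commutes with \<open>A0\<close>. Whether \<open>Y\<close> can be chosen so that the lift commutes with the perturbed matrix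
  is then the linear equation of the preceding lemma; invertibility of the lift is automatic.\<close>

lemma red_GL_centralizer:
  assumes lifts: "\<And>B. B ** map_matrix r A0 = map_matrix r A0 ** B \<Longrightarrow>
      \<exists>B'. map_matrix r B' = B \<and> B' ** A0 = A0 ** B'"
  shows "map_matrix r ` GL_centralizer (A0 + map_matrix ((*) \<pi>) C) =
    {g \<in> GL_centralizer (map_matrix r A0).
      \<exists>Y. g ** map_matrix r C + Y ** map_matrix r A0 = map_matrix r A0 ** Y + map_matrix r C ** g}"
    (is "?L = ?R")
proof (intro subset_antisym subsetI)
  fix g assume "g \<in> ?L"
  then obtain G where G: "g = map_matrix r G" "invertible G"
      "G ** (A0 + map_matrix ((*) \<pi>) C) = (A0 + map_matrix ((*) \<pi>) C) ** G"
    by (auto simp: GL_centralizer_def)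
  have comm: "g ** map_matrix r A0 = map_matrix r A0 ** g"
    using arg_cong[OF G(3), of "map_matrix r"] by (simp add: G(1) red_matrix_mult red_matrix_add)
  then obtain G0 where G0: "map_matrix r G0 = g" "G0 ** A0 = A0 ** G0"
    using lifts by blast
  obtain Y where "G = G0 + map_matrix ((*) \<pi>) Y"
    by (rule red_matrix_eqE[of G G0]) (simp add: G(1) G0)
  with commute_first_order_iff[OF G0(2), of Y C] G(3) G0(1)
  have "g ** map_matrix r C + map_matrix r Y ** map_matrix r A0 =
      map_matrix r A0 ** map_matrix r Y + map_matrix r C ** g"
    by simp
  then show "g \<in> ?R"
    using comm invertible_red[OF G(2)] by (auto simp: GL_centralizer_def G(1))
next
  fix g assume "g \<in> ?R"
  then obtain Y where g: "invertible g" "g ** map_matrix r A0 = map_matrix r A0 ** g"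
    and Y: "g ** map_matrix r C + Y ** map_matrix r A0 = map_matrix r A0 ** Y + map_matrix r C ** g"
    by (auto simp: GL_centralizer_def)
  obtain G0 where G0: "map_matrix r G0 = g" "G0 ** A0 = A0 ** G0"
    using lifts g(2) by blast
  obtain Y' where Y': "map_matrix r Y' = Y" by (rule red_matrix_surj)
  let ?G = "G0 + map_matrix ((*) \<pi>) Y'"
  have red: "map_matrix r ?G = g" by (simp add: red_matrix_add G0)
  have "invertible ?G" by (rule invertible_lift) (simp add: red g)
  moreover have "?G ** (A0 + map_matrix ((*) \<pi>) C) = (A0 + map_matrix ((*) \<pi>) C) ** ?G"
    using commute_first_order_iff[OF G0(2), of Y' C] Y by (simp add: G0 Y')
  ultimately have "?G \<in> GL_centralizer (A0 + map_matrix ((*) \<pi>) C)"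
    by (simp add: GL_centralizer_def)
  with red show "g \<in> ?L" by blast
qed

end

section \<open>The action of an automorphism on extension classes\<close>

lemma module_hom_setD:
  assumes "h \<in> module_hom_set S M N"
  shows "x \<in> carrier M \<Longrightarrow> h x \<in> carrier N"
    and "x \<in> carrier M \<Longrightarrow> y \<in> carrier M \<Longrightarrow> h (x \<oplus>\<^bsub>M\<^esub> y) = h x \<oplus>\<^bsub>N\<^esub> h y"
    and "s \<in> carrier S \<Longrightarrow> x \<in> carrier M \<Longrightarrow> h (s \<odot>\<^bsub>M\<^esub> x) = s \<odot>\<^bsub>N\<^esub> h x"
  using assms by (auto simp: module_hom_set_def hom_def)

lemma module_hom_setI:
  assumes "\<And>x. x \<in> carrier M \<Longrightarrow> h x \<in> carrier N"
    and "\<And>x y. x \<in> carrier M \<Longrightarrow> y \<in> carrier M \<Longrightarrow> h (x \<oplus>\<^bsub>M\<^esub> y) = h x \<oplus>\<^bsub>N\<^esub> h y"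
    and "\<And>s x. s \<in> carrier S \<Longrightarrow> x \<in> carrier M \<Longrightarrow> h (s \<odot>\<^bsub>M\<^esub> x) = s \<odot>\<^bsub>N\<^esub> h x"
  shows "h \<in> module_hom_set S M N"
  using assms by (auto simp: module_hom_set_def hom_def)

lemma module_hom_abelian_group_hom:
  assumes "abelian_group M" "abelian_group N" "h \<in> module_hom_set S M N"
  shows "abelian_group_hom M N h"
proof -
  interpret M: abelian_group M by fact
  interpret N: abelian_group N by fact
  have "group_hom (add_monoid M) (add_monoid N) h"
    using assms(3) by (auto simp: module_hom_set_def group_hom_def group_hom_axioms_def
        intro: M.a_group N.a_group)
  then show ?thesis
    by (intro abelian_group_hom.intro abelian_group_hom_axioms.intro assms(1,2))
qed

lemma is_extensionD:
  assumes "is_extension S N M (E, i, q)"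
  shows "Module.module S E" "abelian_group E" "i \<in> module_hom_set S M E" "q \<in> module_hom_set S E N"
    and "inj_on i (carrier M)" "i ` carrier M = {x \<in> carrier E. q x = \<zero>\<^bsub>N\<^esub>}"
    and "q ` carrier E = carrier N"
  using assms by (auto simp: is_extension_def dest: Module.module.axioms)

lemma extension_fibre:
  assumes ext: "is_extension S N M (E, i, q)" and N: "abelian_group N"
    and xy: "x \<in> carrier E" "y \<in> carrier E" "q x = q y"
  obtains a where "a \<in> carrier M" "x = i a \<oplus>\<^bsub>E\<^esub> y"
proof -
  note D = is_extensionD[OF ext]
  interpret E: abelian_group E by (rule D)
  interpret q: abelian_group_hom E N q by (rule module_hom_abelian_group_hom[OF D(2) N D(4)])
  have "x \<ominus>\<^bsub>E\<^esub> y \<in> {x \<in> carrier E. q x = \<zero>\<^bsub>N\<^esub>}"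
    using xy by (simp add: a_minus_def q.H.r_neg)
  then obtain a where "a \<in> carrier M" "x \<ominus>\<^bsub>E\<^esub> y = i a" unfolding D(6)[symmetric] by auto
  then show ?thesis
    using that xy by (metis E.minus_closed E.r_neg E.r_zero E.add.inv_closed E.l_neg E.a_assoc a_minus_def)
qed

lemma extension_morphism_comp:
  assumes "extension_morphism S M f g \<E> \<F> \<phi>"
    and "extension_morphism S M f' g' \<F> \<G> \<psi>"
    and "\<And>a. a \<in> carrier M \<Longrightarrow> f a \<in> carrier M"
  shows "extension_morphism S M (\<lambda>a. f' (f a)) (\<lambda>b. g' (g b)) \<E> \<G> (\<psi> \<circ> \<phi>)"
  using assms unfolding extension_morphism_def
  by (cases \<E>; cases \<F>; cases \<G>) (auto intro!: module_hom_setI simp: module_hom_setD)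

lemma extension_morphism_cong:
  assumes "is_extension S N M \<E>" "extension_morphism S M f g \<E> \<F> \<phi>"
    and "\<And>a. a \<in> carrier M \<Longrightarrow> f a = f' a" "\<And>b. b \<in> carrier N \<Longrightarrow> g b = g' b"
  shows "extension_morphism S M f' g' \<E> \<F> \<phi>"
proof -
  obtain E i q where E: "\<E> = (E, i, q)" by (cases \<E>)
  have "q x \<in> carrier N" if "x \<in> carrier E" for x
    using module_hom_setD(1)[OF is_extensionD(4)[OF assms(1)[unfolded E]] that] .
  then show ?thesis
    using assms(2-4) by (cases \<F>) (simp add: extension_morphism_def E)
qed

text \<open>This is the five lemma, together with the fact that the inverse bijection is again a morphism.
  It is what turns equivalence of extensions into a symmetric relation.\<close>

lemma extension_morphism_inverse:
  assumes M: "abelian_group M" and N: "abelian_group N"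
    and E: "is_extension S N M (E, i, q)" and E': "is_extension S N M (E', i', q')"
    and mor: "extension_morphism S M f g (E, i, q) (E', i', q') \<phi>"
    and f: "\<And>a. a \<in> carrier M \<Longrightarrow> f a \<in> carrier M"
      "\<And>a. a \<in> carrier M \<Longrightarrow> f' a \<in> carrier M \<and> f (f' a) = a \<and> f' (f a) = a"
    and g: "\<And>b. b \<in> carrier N \<Longrightarrow> g' b \<in> carrier N \<and> g (g' b) = b \<and> g' (g b) = b"
    and f0: "f \<zero>\<^bsub>M\<^esub> = \<zero>\<^bsub>M\<^esub>"
  shows "\<exists>\<psi>. extension_morphism S M f' g' (E', i', q') (E, i, q) \<psi>"
proof -
  note D = is_extensionD[OF E] and D' = is_extensionD[OF E']
  interpret E: Module.module S E by (rule D)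
  interpret E': Module.module S E' by (rule D')
  interpret M: abelian_group M by (rule M)
  have phi: "\<phi> \<in> module_hom_set S E E'" "\<And>a. a \<in> carrier M \<Longrightarrow> \<phi> (i a) = i' (f a)"
    "\<And>x. x \<in> carrier E \<Longrightarrow> q' (\<phi> x) = g (q x)"
    using mor by (auto simp: extension_morphism_def)
  interpret phi: abelian_group_hom E E' \<phi> by (rule module_hom_abelian_group_hom[OF D(2) D'(2) phi(1)])
  interpret i': abelian_group_hom M E' i' by (rule module_hom_abelian_group_hom[OF M D'(2) D'(3)])
  interpret i: abelian_group_hom M E i by (rule module_hom_abelian_group_hom[OF M D(2) D(3)])
  note closed = module_hom_setD(1)[OF D(3)] module_hom_setD(1)[OF D(4)]
    module_hom_setD(1)[OF D'(3)] module_hom_setD(1)[OF D'(4)]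
  have inj: "inj_on \<phi> (carrier E)"
  proof (rule inj_onI)
    fix x y assume xy: "x \<in> carrier E" "y \<in> carrier E" "\<phi> x = \<phi> y"
    then have "q x = q y" using phi(3) g closed(2) by metis
    then obtain a where a: "a \<in> carrier M" "x = i a \<oplus>\<^bsub>E\<^esub> y"
      using extension_fibre[OF E N] xy by metis
    then have "i' (f a) \<oplus>\<^bsub>E'\<^esub> \<phi> y = \<phi> y"
      using xy phi(2)[of a] phi.hom_add[of "i a" y] closed(1)[of a] by simp
    then have "i' (f a) = \<zero>\<^bsub>E'\<^esub>"
      using xy closed(3) f(1)[OF a(1)] by (simp add: E'.M.add.l_cancel_one)
    then have "f a = f \<zero>\<^bsub>M\<^esub>"
      using D'(5) a f f0 i'.hom_zero by (metis M.zero_closed inj_onD)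
    then have "a = \<zero>\<^bsub>M\<^esub>" using f a by (metis M.zero_closed)
    then show "x = y" using a xy by simp
  qed
  have sur: "y \<in> \<phi> ` carrier E" if y: "y \<in> carrier E'" for y
  proof -
    have "g' (q' y) \<in> q ` carrier E" unfolding D(7) using g closed(4) y by blast
    then obtain x where x: "x \<in> carrier E" "q x = g' (q' y)" by auto
    then have "q' y = q' (\<phi> x)" using phi(3) g closed(4) y by simp
    then obtain a where a: "a \<in> carrier M" "y = i' a \<oplus>\<^bsub>E'\<^esub> \<phi> x"
      using extension_fibre[OF E' N] x y by (metis phi.hom_closed)
    then have "y = \<phi> (i (f' a) \<oplus>\<^bsub>E\<^esub> x)"
      using phi(2) f x by simp
    then show ?thesis using a x f by (metis E.M.a_closed closed(1) imageI)
  qed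
  define \<psi> where "\<psi> = inv_into (carrier E) \<phi>"
  have psi: "\<psi> y \<in> carrier E" "\<phi> (\<psi> y) = y" if "y \<in> carrier E'" for y
    using sur[OF that] by (auto simp: \<psi>_def inv_into_into f_inv_into_f)
  have psi_eq: "\<psi> y = x" if "x \<in> carrier E" "y = \<phi> x" for x y
    using that inj by (simp add: \<psi>_def)
  have "\<psi> \<in> module_hom_set S E' E"
  proof (rule module_hom_setI)
    fix x y assume "x \<in> carrier E'" "y \<in> carrier E'"
    then show "\<psi> (x \<oplus>\<^bsub>E'\<^esub> y) = \<psi> x \<oplus>\<^bsub>E\<^esub> \<psi> y"
      by (intro psi_eq) (simp_all add: psi)
  next
    fix s x assume "s \<in> carrier S" "x \<in> carrier E'"
    then show "\<psi> (s \<odot>\<^bsub>E'\<^esub> x) = s \<odot>\<^bsub>E\<^esub> \<psi> x"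
      by (intro psi_eq) (simp_all add: psi module_hom_setD(3)[OF phi(1)])
  qed (rule psi)
  moreover have "\<psi> (i' a) = i (f' a)" if "a \<in> carrier M" for a
    using that f by (intro psi_eq) (auto simp: phi(2))
  moreover have "q (\<psi> y) = g' (q' y)" if "y \<in> carrier E'" for y
    using phi(3)[of "\<psi> y"] psi[OF that] g closed(2) by metis
  ultimately show ?thesis
    by (auto simp: extension_morphism_def)
qed

lemma Ext1_eq_extension_class:
  fixes \<xi> :: "('s, 'a, 'e, 'b) extn set"
  assumes M: "abelian_group M" and N: "abelian_group N"
    and \<xi>: "\<xi> \<in> Ext1 S N M" and F: "\<F> \<in> \<xi>"
  shows "is_extension S N M \<F>" "\<xi> = extension_class S N M \<F>"
proof -
  obtain \<E> :: "('s, 'a, 'e, 'b) extn" where E: "is_extension S N M \<E>"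
    "\<xi> = {\<F>. is_extension S N M \<F> \<and> extension_equiv S M \<E> \<F>}"
    using \<xi> unfolding Ext1_def quotient_def by blast
  then show ext: "is_extension S N M \<F>" using F by blast
  obtain E i q F' j p where EF: "\<E> = (E, i, q)" "\<F> = (F', j, p)" by (cases \<E>; cases \<F>) auto
  obtain \<phi> where phi: "extension_morphism S M (\<lambda>a. a) (\<lambda>b. b) \<E> \<F> \<phi>"
    using E F by (auto simp: extension_equiv_def)
  obtain \<psi> where psi: "extension_morphism S M (\<lambda>a. a) (\<lambda>b. b) \<F> \<E> \<psi>"
    using extension_morphism_inverse[OF M N E(1)[unfolded EF] ext[unfolded EF] phi[unfolded EF],
        of "\<lambda>a. a" "\<lambda>b. b"] by (auto simp: EF)
  show "\<xi> = extension_class S N M \<F>"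
    using extension_morphism_comp[OF phi] extension_morphism_comp[OF psi]
    unfolding E(2) extension_class_def extension_equiv_def by blast
qed

text \<open>If \<open>\<xi>\<close> is stable, the chosen member \<open>\<F>\<close> receives a morphism over \<open>g\<close> from some member of \<open>\<xi>\<close>,
  which is itself equivalent to \<open>\<F>\<close>; composing gives an endomorphism of \<open>\<F>\<close>. Conversely,
  any morphism over \<open>g\<close> from \<open>\<F>\<close> to some \<open>\<G>\<close> becomes an equivalence after precomposition with the
  inverse of an endomorphism of \<open>\<F>\<close> over \<open>g\<close>.\<close>

lemma Ext1_act_fixes_iff:
  assumes M: "abelian_group M" and \<xi>: "\<xi> \<in> Ext1 S M M" and F: "\<F> \<in> \<xi>"
    and g: "\<And>a. a \<in> carrier M \<Longrightarrow> g a \<in> carrier M"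
      "\<And>a. a \<in> carrier M \<Longrightarrow> g' a \<in> carrier M \<and> g (g' a) = a \<and> g' (g a) = a"
      "g \<zero>\<^bsub>M\<^esub> = \<zero>\<^bsub>M\<^esub>"
  shows "Ext1_act S M g \<xi> = \<xi> \<longleftrightarrow> (\<exists>\<phi>. extension_morphism S M g g \<F> \<F> \<phi>)"
proof -
  have ext: "is_extension S M M \<F>" and xi: "\<xi> = extension_class S M M \<F>"
    using Ext1_eq_extension_class[OF M M \<xi> F] by auto
  have member: "\<G> \<in> \<xi> \<longleftrightarrow> is_extension S M M \<G> \<and>
      (\<exists>\<phi>. extension_morphism S M (\<lambda>a. a) (\<lambda>b. b) \<F> \<G> \<phi>)" for \<G>
    by (auto simp: xi extension_class_def extension_equiv_def)
  note comp = extension_morphism_comp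
  show ?thesis
  proof
    assume "Ext1_act S M g \<xi> = \<xi>"
    then obtain \<E> \<phi> where E: "\<E> \<in> \<xi>" and phi: "extension_morphism S M g g \<E> \<F> \<phi>"
      using F unfolding Ext1_act_def by blast
    then obtain \<alpha> where "extension_morphism S M (\<lambda>a. a) (\<lambda>b. b) \<F> \<E> \<alpha>"
      by (auto simp: member)
    from comp[OF this phi] show "\<exists>\<phi>. extension_morphism S M g g \<F> \<F> \<phi>"
      by blast
  next
    assume "\<exists>\<phi>. extension_morphism S M g g \<F> \<F> \<phi>"
    then obtain \<phi> where phi: "extension_morphism S M g g \<F> \<F> \<phi>" by blast
    obtain F' j p where F': "\<F> = (F', j, p)" by (cases \<F>)
    obtain \<psi> where psi: "extension_morphism S M g' g' \<F> \<F> \<psi>"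
      using extension_morphism_inverse[OF M M ext[unfolded F'] ext[unfolded F'] phi[unfolded F'] g(1) g(2) g(2) g(3)]
      unfolding F' by blast
    show "Ext1_act S M g \<xi> = \<xi>"
    proof (intro subset_antisym subsetI)
      fix \<G> assume "\<G> \<in> Ext1_act S M g \<xi>"
      then obtain \<E> \<beta> where G: "is_extension S M M \<G>" "\<E> \<in> \<xi>"
        and \<beta>: "extension_morphism S M g g \<E> \<G> \<beta>"
        by (auto simp: Ext1_act_def)
      then obtain \<alpha> where \<alpha>: "extension_morphism S M (\<lambda>a. a) (\<lambda>b. b) \<F> \<E> \<alpha>"
        by (auto simp: member)
      obtain \<gamma> where \<gamma>: "extension_morphism S M g g \<F> \<G> \<gamma>"
        using comp[OF \<alpha> \<beta>] by blast
      obtain \<delta> where "extension_morphism S M (\<lambda>a. g (g' a)) (\<lambda>a. g (g' a)) \<F> \<G> \<delta>"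
        using comp[OF psi \<gamma> g(2)[THEN conjunct1]] by blast
      then have "extension_morphism S M (\<lambda>a. a) (\<lambda>b. b) \<F> \<G> \<delta>"
        by (rule extension_morphism_cong[OF ext]) (rule g(2)[THEN conjunct2, THEN conjunct1], assumption)+
      with G(1) show "\<G> \<in> \<xi>" unfolding member by blast
    next
      fix \<G> assume "\<G> \<in> \<xi>"
      then obtain \<alpha> where G: "is_extension S M M \<G>"
        and \<alpha>: "extension_morphism S M (\<lambda>a. a) (\<lambda>b. b) \<F> \<G> \<alpha>"
        by (auto simp: member)
      obtain \<gamma> where "extension_morphism S M g g \<F> \<G> \<gamma>"
        using comp[OF phi \<alpha> g(1)] by blast
      then show "\<G> \<in> Ext1_act S M g \<xi>"
        using G F by (auto simp: Ext1_act_def)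
    qed
  qed
qed

section \<open>Extensions of polynomial modules with a linear section\<close>

lemma matrix_module_simps [simp]:
  "carrier (matrix_module A) = UNIV"
  "x \<oplus>\<^bsub>matrix_module A\<^esub> y = x + y"
  "\<zero>\<^bsub>matrix_module A\<^esub> = 0"
  "[:c:] \<odot>\<^bsub>matrix_module A\<^esub> x = c *s x"
  "[:0, 1:] \<odot>\<^bsub>matrix_module A\<^esub> x = A *v x"
  by (simp_all add: matrix_module_def)

lemma abelian_group_matrix_module: "abelian_group (matrix_module A)"
proof (rule abelian_groupI)
  fix x assume "x \<in> carrier (matrix_module A)"
  have "- x + x = 0" by simp
  then show "\<exists>y\<in>carrier (matrix_module A). y \<oplus>\<^bsub>matrix_module A\<^esub> x = \<zero>\<^bsub>matrix_module A\<^esub>"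
    by (intro bexI[of _ "- x"]) simp_all
qed (simp_all add: add_ac)

lemma linear_map_matrix:
  fixes h :: "'a::comm_ring_1 ^ 'n \<Rightarrow> 'a ^ 'm"
  assumes add: "\<And>x y. h (x + y) = h x + h y" and smult: "\<And>c x. h (c *s x) = c *s h x"
  shows "h x = matrix h *v x"
proof -
  have h0: "h 0 = 0" using add[of 0 0] by simp
  have sum: "h (sum f I) = (\<Sum>i\<in>I. h (f i))" for f and I :: "'n set"
    by (induction I rule: infinite_finite_induct) (simp_all add: add h0)
  have "h x = h (\<Sum>i\<in>UNIV. (x $ i) *s axis i 1)" by (simp only: basis_expansion)
  also have "\<dots> = (\<Sum>i\<in>UNIV. (x $ i) *s h (axis i 1))" by (simp add: sum smult)
  also have "\<dots> = matrix h *v x" by (simp add: matrix_mult_sum column_def matrix_def)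
  finally show ?thesis .
qed

text \<open>Modules over a ring that is a whole type: the module laws hold without side conditions on the
  scalars.\<close>

locale type_module =
  fixes E :: "('s::comm_ring_1, 'e) module"
  assumes type_module: "Module.module ring_of_type_algebra E"
begin

sublocale E: abelian_group E
  using type_module by (rule Module.module.axioms(2))

lemma smult_closed [simp]: "x \<in> carrier E \<Longrightarrow> a \<odot>\<^bsub>E\<^esub> x \<in> carrier E"
  using Module.module.smult_closed[OF type_module] by simp

lemma smult_add_left: "x \<in> carrier E \<Longrightarrow> (a + b) \<odot>\<^bsub>E\<^esub> x = a \<odot>\<^bsub>E\<^esub> x \<oplus>\<^bsub>E\<^esub> b \<odot>\<^bsub>E\<^esub> x"
  using Module.module.smult_l_distr[OF type_module, of a b x] by simp

lemma smult_add_right: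
  "x \<in> carrier E \<Longrightarrow> y \<in> carrier E \<Longrightarrow> a \<odot>\<^bsub>E\<^esub> (x \<oplus>\<^bsub>E\<^esub> y) = a \<odot>\<^bsub>E\<^esub> x \<oplus>\<^bsub>E\<^esub> a \<odot>\<^bsub>E\<^esub> y"
  using Module.module.smult_r_distr[OF type_module, of a x y] by simp

lemma smult_smult: "x \<in> carrier E \<Longrightarrow> a \<odot>\<^bsub>E\<^esub> (b \<odot>\<^bsub>E\<^esub> x) = (a * b) \<odot>\<^bsub>E\<^esub> x"
  using Module.module.smult_assoc1[OF type_module, of a b x] by simp

lemma smult_one [simp]: "x \<in> carrier E \<Longrightarrow> 1 \<odot>\<^bsub>E\<^esub> x = x"
  using Module.module.smult_one[OF type_module] by simp

lemma smult_zero_left [simp]: "x \<in> carrier E \<Longrightarrow> 0 \<odot>\<^bsub>E\<^esub> x = \<zero>\<^bsub>E\<^esub>"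
  using Module.module.smult_l_null[OF type_module] by simp

lemma smult_zero_right [simp]: "a \<odot>\<^bsub>E\<^esub> \<zero>\<^bsub>E\<^esub> = \<zero>\<^bsub>E\<^esub>"
  using Module.module.smult_r_null[OF type_module] by simp

lemma finsum_smult:
  assumes "finite I" "f \<in> I \<rightarrow> carrier E"
  shows "a \<odot>\<^bsub>E\<^esub> finsum E f I = (\<Oplus>\<^bsub>E\<^esub>i\<in>I. a \<odot>\<^bsub>E\<^esub> f i)"
  using Module.module.finsum_smult_ldistr[OF type_module assms(1) _ assms(2)] by simp

end

text \<open>The constants and the variable generate the polynomial ring, so linearity needs to be checked
  only for them.\<close>

lemma module_hom_poly_ringI:
  fixes E :: "('s::comm_ring_1 poly, 'e) module" and F :: "('s poly, 'f) module"
  assumes E: "Module.module ring_of_type_algebra E" and F: "Module.module ring_of_type_algebra F"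
    and closed: "\<And>x. x \<in> carrier E \<Longrightarrow> h x \<in> carrier F"
    and add: "\<And>x y. x \<in> carrier E \<Longrightarrow> y \<in> carrier E \<Longrightarrow> h (x \<oplus>\<^bsub>E\<^esub> y) = h x \<oplus>\<^bsub>F\<^esub> h y"
    and const: "\<And>c x. x \<in> carrier E \<Longrightarrow> h ([:c:] \<odot>\<^bsub>E\<^esub> x) = [:c:] \<odot>\<^bsub>F\<^esub> h x"
    and var: "\<And>x. x \<in> carrier E \<Longrightarrow> h ([:0, 1:] \<odot>\<^bsub>E\<^esub> x) = [:0, 1:] \<odot>\<^bsub>F\<^esub> h x"
  shows "h \<in> module_hom_set ring_of_type_algebra E F"
proof (rule module_hom_setI)
  interpret E: type_module E by (rule type_module.intro[OF E])
  interpret F: type_module F by (rule type_module.intro[OF F])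
  fix s :: "'s poly" and x assume x: "x \<in> carrier E"
  show "h (s \<odot>\<^bsub>E\<^esub> x) = s \<odot>\<^bsub>F\<^esub> h x"
  proof (induction s)
    case 0
    have "h ([:0:] \<odot>\<^bsub>E\<^esub> x) = [:0:] \<odot>\<^bsub>F\<^esub> h x" by (rule const[OF x])
    then show ?case by simp
  next
    case (pCons a s)
    have split: "pCons a s = [:a:] + [:0, 1:] * s" by simp
    show ?case
      unfolding split
      using x pCons.IH by (simp add: E.smult_add_left F.smult_add_left E.smult_smult[symmetric]
          F.smult_smult[symmetric] closed add const var del: mult_pCons_left)
  qed
qed (use closed add in auto)

locale matrix_extension =
  fixes A :: "'k::field ^ 'n ^ 'n" and F :: "('k poly, 'f) module"
    and j :: "'k ^ 'n \<Rightarrow> 'f" and p :: "'f \<Rightarrow> 'k ^ 'n"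
  assumes ext: "is_extension ring_of_type_algebra (matrix_module A) (matrix_module A) (F, j, p)"
begin

sublocale F: type_module F
  by (rule type_module.intro[OF is_extensionD(1)[OF ext]])

lemmas hom_j = module_hom_setD[OF is_extensionD(3)[OF ext], simplified]
lemmas hom_p = module_hom_setD[OF is_extensionD(4)[OF ext], simplified]

lemma j_const: "j (c *s x) = [:c:] \<odot>\<^bsub>F\<^esub> j x" and j_var: "j (A *v x) = [:0, 1:] \<odot>\<^bsub>F\<^esub> j x"
  using hom_j(3)[of "[:c:]" x] hom_j(3)[of "[:0, 1:]" x] by simp_all

lemma p_const: "x \<in> carrier F \<Longrightarrow> p ([:c:] \<odot>\<^bsub>F\<^esub> x) = c *s p x"
  and p_var: "x \<in> carrier F \<Longrightarrow> p ([:0, 1:] \<odot>\<^bsub>F\<^esub> x) = A *v p x"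
  by (simp_all add: hom_p)

lemma inj_j: "j x = j y \<longleftrightarrow> x = y"
  using is_extensionD(5)[OF ext] by (auto dest: injD)

lemma p_j [simp]: "p (j x) = 0"
  using is_extensionD(6)[OF ext] by auto

lemma fibre:
  assumes "x \<in> carrier F" "y \<in> carrier F" "p x = p y"
  obtains a where "x = j a \<oplus>\<^bsub>F\<^esub> y"
  using extension_fibre[OF ext abelian_group_matrix_module assms] by auto

lemma fibre_coordinate_unique:
  "y \<in> carrier F \<Longrightarrow> j a \<oplus>\<^bsub>F\<^esub> y = j b \<oplus>\<^bsub>F\<^esub> y \<longleftrightarrow> a = b"
  using F.E.add.right_cancel[of y "j a" "j b"] by (simp add: hom_j inj_j)

text \<open>Two linear maps into the extension with the same projection differ by a linear map into the
  submodule. This provides both the matrix \<open>C\<close> of a section and the matrix \<open>Y\<close> of an endomorphism.\<close>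

lemma difference_matrix:
  fixes u v :: "'k ^ 'n \<Rightarrow> 'f"
  assumes closed: "\<And>x. u x \<in> carrier F" "\<And>x. v x \<in> carrier F"
    and add: "\<And>x y. u (x + y) = u x \<oplus>\<^bsub>F\<^esub> u y" "\<And>x y. v (x + y) = v x \<oplus>\<^bsub>F\<^esub> v y"
    and smult: "\<And>c x. u (c *s x) = [:c:] \<odot>\<^bsub>F\<^esub> u x" "\<And>c x. v (c *s x) = [:c:] \<odot>\<^bsub>F\<^esub> v x"
    and p: "\<And>x. p (u x) = p (v x)"
  obtains Y where "\<And>x. u x = j (Y *v x) \<oplus>\<^bsub>F\<^esub> v x"
proof -
  have "\<exists>a. u x = j a \<oplus>\<^bsub>F\<^esub> v x" for x
    using fibre[OF closed p] by metis
  then obtain h where h: "u x = j (h x) \<oplus>\<^bsub>F\<^esub> v x" for x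
    by metis
  have "j (h (x + y)) \<oplus>\<^bsub>F\<^esub> v (x + y) = j (h x + h y) \<oplus>\<^bsub>F\<^esub> v (x + y)" for x y
    using add(1)[of x y] unfolding h
    by (simp add: add(2) closed hom_j F.E.a_ac)
  then have "h (x + y) = h x + h y" for x y
    by (simp add: fibre_coordinate_unique closed)
  moreover have "j (h (c *s x)) \<oplus>\<^bsub>F\<^esub> v (c *s x) = j (c *s h x) \<oplus>\<^bsub>F\<^esub> v (c *s x)" for c x
    using smult(1)[of c x] unfolding h
    by (simp add: smult(2) closed hom_j(1) j_const F.smult_add_right)
  then have "h (c *s x) = c *s h x" for c x
    by (metis fibre_coordinate_unique closed(2))
  ultimately show ?thesis
    using linear_map_matrix[of h] h that by metis
qed

end

locale sectioned_matrix_extension = matrix_extension A F j p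
  for A :: "'k::field ^ 'n ^ 'n" and F :: "('k poly, 'f) module" and j p +
  fixes s :: "'k ^ 'n \<Rightarrow> 'f"
  assumes s_closed [simp]: "s x \<in> carrier F" and s_add: "s (x + y) = s x \<oplus>\<^bsub>F\<^esub> s y"
    and s_const: "s (c *s x) = [:c:] \<odot>\<^bsub>F\<^esub> s x" and p_s [simp]: "p (s x) = x"
begin

text \<open>The matrix \<open>C\<close> represents the class of the extension in the quotient of all matrices by the
  commutators with \<open>A\<close>.\<close>

lemma var_section:
  obtains C where "\<And>x. [:0, 1:] \<odot>\<^bsub>F\<^esub> s x = j (C *v x) \<oplus>\<^bsub>F\<^esub> s (A *v x)"
proof (rule difference_matrix)
  fix c x
  show "[:0, 1:] \<odot>\<^bsub>F\<^esub> s (c *s x) = [:c:] \<odot>\<^bsub>F\<^esub> ([:0, 1:] \<odot>\<^bsub>F\<^esub> s x)"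
    by (simp add: s_const F.smult_smult)
  show "s (A *v (c *s x)) = [:c:] \<odot>\<^bsub>F\<^esub> s (A *v x)"
    by (simp add: s_const matrix_vector_mult_smult)
qed (simp_all add: s_add F.smult_add_right matrix_vector_right_distrib p_var)

lemma coordinates:
  assumes "x \<in> carrier F"
  obtains a where "x = j a \<oplus>\<^bsub>F\<^esub> s (p x)"
  using fibre[OF assms, of "s (p x)"] by auto

lemma p_coordinates: "p (j a \<oplus>\<^bsub>F\<^esub> s x) = x"
  by (simp add: hom_p hom_j)

lemma coordinates_add:
  "(j a \<oplus>\<^bsub>F\<^esub> s x) \<oplus>\<^bsub>F\<^esub> (j b \<oplus>\<^bsub>F\<^esub> s y) = j (a + b) \<oplus>\<^bsub>F\<^esub> s (x + y)"
  by (simp add: hom_j s_add F.E.a_ac)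

text \<open>An endomorphism over \<open>g\<close> is determined by its values \<open>j (Y x) + s (g x)\<close> on the section; the
  equation for \<open>Y\<close> expresses that it commutes with the variable there. Conversely, a solution \<open>Y\<close>
  defines an endomorphism through the unique representation of elements as \<open>j a + s x\<close>.\<close>

lemma self_morphism_iff:
  assumes C: "\<And>x. [:0, 1:] \<odot>\<^bsub>F\<^esub> s x = j (C *v x) \<oplus>\<^bsub>F\<^esub> s (A *v x)"
    and comm: "g ** A = A ** g"
  shows "(\<exists>\<phi>. extension_morphism ring_of_type_algebra (matrix_module A) ((*v) g) ((*v) g)
        (F, j, p) (F, j, p) \<phi>) \<longleftrightarrow> (\<exists>Y. g ** C + Y ** A = A ** Y + C ** g)"
proof
  assume "\<exists>\<phi>. extension_morphism ring_of_type_algebra (matrix_module A) ((*v) g) ((*v) g)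
        (F, j, p) (F, j, p) \<phi>"
  then obtain \<phi> where hom: "\<phi> \<in> module_hom_set ring_of_type_algebra F F"
    and phi_j: "\<And>a. \<phi> (j a) = j (g *v a)" and p_phi: "\<And>x. x \<in> carrier F \<Longrightarrow> p (\<phi> x) = g *v p x"
    by (auto simp: extension_morphism_def)
  note phi = module_hom_setD[OF hom, simplified]
  obtain Y where Y: "\<And>x. \<phi> (s x) = j (Y *v x) \<oplus>\<^bsub>F\<^esub> s (g *v x)"
  proof (rule difference_matrix)
    fix c x
    show "\<phi> (s (c *s x)) = [:c:] \<odot>\<^bsub>F\<^esub> \<phi> (s x)"
      by (simp add: s_const phi)
    show "s (g *v (c *s x)) = [:c:] \<odot>\<^bsub>F\<^esub> s (g *v x)"
      by (simp add: s_const matrix_vector_mult_smult)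
  qed (simp_all add: s_add phi matrix_vector_right_distrib p_phi)
  have "(g ** C + Y ** A) *v x = (A ** Y + C ** g) *v x" for x
  proof -
    have gA: "g *v (A *v x) = A *v (g *v x)"
      by (simp add: matrix_vector_mul_assoc comm)
    have "\<phi> ([:0, 1:] \<odot>\<^bsub>F\<^esub> s x) = j (g *v (C *v x)) \<oplus>\<^bsub>F\<^esub> (j (Y *v (A *v x)) \<oplus>\<^bsub>F\<^esub> s (g *v (A *v x)))"
      by (simp add: C phi phi_j hom_j(1) Y)
    also have "\<dots> = j (g *v (C *v x) + Y *v (A *v x)) \<oplus>\<^bsub>F\<^esub> s (A *v (g *v x))"
      by (simp add: hom_j gA F.E.a_assoc)
    finally have l: "\<phi> ([:0, 1:] \<odot>\<^bsub>F\<^esub> s x) = j (g *v (C *v x) + Y *v (A *v x)) \<oplus>\<^bsub>F\<^esub> s (A *v (g *v x))" .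
    have "[:0, 1:] \<odot>\<^bsub>F\<^esub> \<phi> (s x) = j (A *v (Y *v x)) \<oplus>\<^bsub>F\<^esub> (j (C *v (g *v x)) \<oplus>\<^bsub>F\<^esub> s (A *v (g *v x)))"
      by (simp add: Y F.smult_add_right hom_j(1) j_var C)
    also have "\<dots> = j (A *v (Y *v x) + C *v (g *v x)) \<oplus>\<^bsub>F\<^esub> s (A *v (g *v x))"
      by (simp add: hom_j F.E.a_assoc)
    finally have "j (g *v (C *v x) + Y *v (A *v x)) \<oplus>\<^bsub>F\<^esub> s (A *v (g *v x)) =
        j (A *v (Y *v x) + C *v (g *v x)) \<oplus>\<^bsub>F\<^esub> s (A *v (g *v x))"
      using l phi(3)[of "s x" "[:0, 1:]"] by simp
    then show ?thesis
      by (simp add: fibre_coordinate_unique matrix_vector_mult_add_rdistrib matrix_vector_mul_assoc)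
  qed
  then show "\<exists>Y. g ** C + Y ** A = A ** Y + C ** g"
    by (metis matrix_eq)
next
  assume "\<exists>Y. g ** C + Y ** A = A ** Y + C ** g"
  then obtain Y where Y: "g ** C + Y ** A = A ** Y + C ** g" by blast
  have "\<forall>x\<in>carrier F. \<exists>a. x = j a \<oplus>\<^bsub>F\<^esub> s (p x)" using coordinates by metis
  \<comment> \<open>The map \<open>a\<close> is the coordinate complementary to \<open>p\<close>.\<close>
  then obtain a where a: "\<And>x. x \<in> carrier F \<Longrightarrow> x = j (a x) \<oplus>\<^bsub>F\<^esub> s (p x)" by metis
  define \<phi> where "\<phi> x = j (g *v a x + Y *v p x) \<oplus>\<^bsub>F\<^esub> s (g *v p x)" for x
  have phi: "\<phi> (j b \<oplus>\<^bsub>F\<^esub> s x) = j (g *v b + Y *v x) \<oplus>\<^bsub>F\<^esub> s (g *v x)" for b x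
  proof -
    have "j (a (j b \<oplus>\<^bsub>F\<^esub> s x)) \<oplus>\<^bsub>F\<^esub> s x = j b \<oplus>\<^bsub>F\<^esub> s x"
      using a[of "j b \<oplus>\<^bsub>F\<^esub> s x"] by (simp add: p_coordinates hom_j(1))
    then show ?thesis by (simp add: \<phi>_def p_coordinates fibre_coordinate_unique)
  qed
  have const: "[:c:] \<odot>\<^bsub>F\<^esub> (j b \<oplus>\<^bsub>F\<^esub> s x) = j (c *s b) \<oplus>\<^bsub>F\<^esub> s (c *s x)" for b c x
    by (simp add: F.smult_add_right hom_j(1) j_const s_const)
  have var: "[:0, 1:] \<odot>\<^bsub>F\<^esub> (j b \<oplus>\<^bsub>F\<^esub> s x) = j (A *v b + C *v x) \<oplus>\<^bsub>F\<^esub> s (A *v x)" for b x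
    by (simp add: F.smult_add_right hom_j j_var C F.E.a_assoc)
  have "\<phi> \<in> module_hom_set ring_of_type_algebra F F"
  proof (rule module_hom_poly_ringI[OF F.type_module F.type_module])
    fix x assume x: "x \<in> carrier F"
    show "\<phi> x \<in> carrier F" by (simp add: \<phi>_def hom_j(1))
    have "\<phi> ([:0, 1:] \<odot>\<^bsub>F\<^esub> (j (a x) \<oplus>\<^bsub>F\<^esub> s (p x))) =
        [:0, 1:] \<odot>\<^bsub>F\<^esub> \<phi> (j (a x) \<oplus>\<^bsub>F\<^esub> s (p x))"
    proof -
      have "(g ** C + Y ** A) *v p x = (A ** Y + C ** g) *v p x" using Y by simp
      moreover have "g ** A *v z = A ** g *v z" for z using comm by simp
      ultimately show ?thesis
        by (simp add: var phi matrix_vector_right_distrib matrix_vector_mult_add_rdistrib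
            matrix_vector_mul_assoc add_ac)
    qed
    then show "\<phi> ([:0, 1:] \<odot>\<^bsub>F\<^esub> x) = [:0, 1:] \<odot>\<^bsub>F\<^esub> \<phi> x" using a[OF x] by simp
    fix c
    have "\<phi> ([:c:] \<odot>\<^bsub>F\<^esub> (j (a x) \<oplus>\<^bsub>F\<^esub> s (p x))) = [:c:] \<odot>\<^bsub>F\<^esub> \<phi> (j (a x) \<oplus>\<^bsub>F\<^esub> s (p x))"
      by (simp add: const phi matrix_vector_mult_smult vector_add_ldistrib)
    then show "\<phi> ([:c:] \<odot>\<^bsub>F\<^esub> x) = [:c:] \<odot>\<^bsub>F\<^esub> \<phi> x" using a[OF x] by simp
  next
    fix x y assume xy: "x \<in> carrier F" "y \<in> carrier F"
    have "\<phi> ((j (a x) \<oplus>\<^bsub>F\<^esub> s (p x)) \<oplus>\<^bsub>F\<^esub> (j (a y) \<oplus>\<^bsub>F\<^esub> s (p y))) =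
        \<phi> (j (a x) \<oplus>\<^bsub>F\<^esub> s (p x)) \<oplus>\<^bsub>F\<^esub> \<phi> (j (a y) \<oplus>\<^bsub>F\<^esub> s (p y))"
      by (simp add: coordinates_add phi matrix_vector_right_distrib add_ac)
    then show "\<phi> (x \<oplus>\<^bsub>F\<^esub> y) = \<phi> x \<oplus>\<^bsub>F\<^esub> \<phi> y" using a xy by simp
  qed
  moreover have "\<phi> (j b) = j (g *v b)" for b
  proof -
    have "s 0 = \<zero>\<^bsub>F\<^esub>" using s_const[of 0 0] by simp
    then show ?thesis using phi[of b 0] by (simp add: hom_j(1))
  qed
  moreover have "p (\<phi> x) = g *v p x" for x
    by (simp add: \<phi>_def p_coordinates)
  ultimately show "\<exists>\<phi>. extension_morphism ring_of_type_algebra (matrix_module A) ((*v) g) ((*v) g)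
        (F, j, p) (F, j, p) \<phi>"
    by (auto simp: extension_morphism_def)
qed

end

section \<open>Maps out of the Baer sum\<close>

lemma pullback_module_simps [simp]:
  "carrier (pullback_module M f N g) = {(x, y). x \<in> carrier M \<and> y \<in> carrier N \<and> f x = g y}"
  "(x, y) \<oplus>\<^bsub>pullback_module M f N g\<^esub> (x', y') = (x \<oplus>\<^bsub>M\<^esub> x', y \<oplus>\<^bsub>N\<^esub> y')"
  "\<zero>\<^bsub>pullback_module M f N g\<^esub> = (\<zero>\<^bsub>M\<^esub>, \<zero>\<^bsub>N\<^esub>)"
  "c \<odot>\<^bsub>pullback_module M f N g\<^esub> (x, y) = (c \<odot>\<^bsub>M\<^esub> x, c \<odot>\<^bsub>N\<^esub> y)"
  by (simp_all add: pullback_module_def)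

lemma quotient_module_simps [simp]:
  "carrier (quotient_module M D) = a_rcosets\<^bsub>M\<^esub> D"
  "C \<oplus>\<^bsub>quotient_module M D\<^esub> C' = C <+>\<^bsub>M\<^esub> C'"
  "s \<odot>\<^bsub>quotient_module M D\<^esub> C = (\<Union>x\<in>C. D +>\<^bsub>M\<^esub> (s \<odot>\<^bsub>M\<^esub> x))"
  by (simp_all add: quotient_module_def)

lemma abelian_group_pullback_module:
  assumes f: "abelian_group_hom M L f" and g: "abelian_group_hom N L g"
  shows "abelian_group (pullback_module M f N g)"
proof (rule abelian_groupI)
  interpret f: abelian_group_hom M L f by (rule f)
  interpret g: abelian_group_hom N L g by (rule g)
  let ?P = "pullback_module M f N g"
  fix z assume "z \<in> carrier ?P"
  then obtain x y where "z = (x, y)" "x \<in> carrier M" "y \<in> carrier N" "f x = g y" by auto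
  then show "\<exists>w\<in>carrier ?P. w \<oplus>\<^bsub>?P\<^esub> z = \<zero>\<^bsub>?P\<^esub>"
    by (intro bexI[of _ "(\<ominus>\<^bsub>M\<^esub> x, \<ominus>\<^bsub>N\<^esub> y)"]) (simp_all add: f.G.l_neg g.G.l_neg)
next
  interpret f: abelian_group_hom M L f by (rule f)
  interpret g: abelian_group_hom N L g by (rule g)
  let ?P = "pullback_module M f N g"
  show "\<zero>\<^bsub>?P\<^esub> \<in> carrier ?P" by simp
  fix u v assume uv: "u \<in> carrier ?P" "v \<in> carrier ?P"
  then show "u \<oplus>\<^bsub>?P\<^esub> v \<in> carrier ?P" "u \<oplus>\<^bsub>?P\<^esub> v = v \<oplus>\<^bsub>?P\<^esub> u"
    by (auto simp: f.G.a_comm g.G.a_comm)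
  show "\<zero>\<^bsub>?P\<^esub> \<oplus>\<^bsub>?P\<^esub> u = u" using uv by auto
  fix w assume "w \<in> carrier ?P"
  with uv show "u \<oplus>\<^bsub>?P\<^esub> v \<oplus>\<^bsub>?P\<^esub> w = u \<oplus>\<^bsub>?P\<^esub> (v \<oplus>\<^bsub>?P\<^esub> w)"
    by (auto simp: f.G.a_assoc g.G.a_assoc)
qed

text \<open>A morphism out of the Baer sum is most conveniently used as a map on pairs: it is linear on
  the pullback and agrees with the given inclusion on the copies of \<open>M\<close> in either component. The
  two copies are identified because they differ by the antidiagonal that is divided out.\<close>

lemma baer_sum_universal:
  assumes M: "abelian_group M" "\<And>s a. s \<in> carrier S \<Longrightarrow> a \<in> carrier M \<Longrightarrow> s \<odot>\<^bsub>M\<^esub> a \<in> carrier M"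
    and N: "abelian_group N"
    and E1: "is_extension S N M (E1, i1, q1)" and E2: "is_extension S N M (E2, i2, q2)"
    and mor: "extension_morphism S M (\<lambda>a. a) (\<lambda>b. b) (baer_sum M (E1, i1, q1) (E2, i2, q2)) (E, i, q) \<gamma>"
  obtains \<psi> where
    "\<And>x y. x \<in> carrier E1 \<Longrightarrow> y \<in> carrier E2 \<Longrightarrow> q1 x = q2 y \<Longrightarrow> \<psi> x y \<in> carrier E \<and> q (\<psi> x y) = q1 x"
    "\<And>x y x' y'. x \<in> carrier E1 \<Longrightarrow> y \<in> carrier E2 \<Longrightarrow> q1 x = q2 y \<Longrightarrow>
       x' \<in> carrier E1 \<Longrightarrow> y' \<in> carrier E2 \<Longrightarrow> q1 x' = q2 y' \<Longrightarrow>
       \<psi> (x \<oplus>\<^bsub>E1\<^esub> x') (y \<oplus>\<^bsub>E2\<^esub> y') = \<psi> x y \<oplus>\<^bsub>E\<^esub> \<psi> x' y'"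
    "\<And>s x y. s \<in> carrier S \<Longrightarrow> x \<in> carrier E1 \<Longrightarrow> y \<in> carrier E2 \<Longrightarrow> q1 x = q2 y \<Longrightarrow>
       \<psi> (s \<odot>\<^bsub>E1\<^esub> x) (s \<odot>\<^bsub>E2\<^esub> y) = s \<odot>\<^bsub>E\<^esub> \<psi> x y"
    "\<And>a. a \<in> carrier M \<Longrightarrow> \<psi> (i1 a) \<zero>\<^bsub>E2\<^esub> = i a"
    "\<And>a. a \<in> carrier M \<Longrightarrow> \<psi> \<zero>\<^bsub>E1\<^esub> (i2 a) = i a"
proof -
  note D1 = is_extensionD[OF E1] and D2 = is_extensionD[OF E2]
  interpret M: abelian_group M by (rule M)
  interpret E1: Module.module S E1 by (rule D1)
  interpret E2: Module.module S E2 by (rule D2)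
  interpret q1: abelian_group_hom E1 N q1 by (rule module_hom_abelian_group_hom[OF D1(2) N D1(4)])
  interpret q2: abelian_group_hom E2 N q2 by (rule module_hom_abelian_group_hom[OF D2(2) N D2(4)])
  interpret i1: abelian_group_hom M E1 i1 by (rule module_hom_abelian_group_hom[OF M(1) D1(2) D1(3)])
  interpret i2: abelian_group_hom M E2 i2 by (rule module_hom_abelian_group_hom[OF M(1) D2(2) D2(3)])
  note smult_homs = module_hom_setD(3)[OF D1(3)] module_hom_setD(3)[OF D2(3)]
    module_hom_setD(3)[OF D1(4)] module_hom_setD(3)[OF D2(4)]
  have qi [simp]: "q1 (i1 a) = \<zero>\<^bsub>N\<^esub>" "q2 (i2 a) = \<zero>\<^bsub>N\<^esub>" if "a \<in> carrier M" for a
    using D1(6) D2(6) that by auto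
  have minus_zero_N [simp]: "\<ominus>\<^bsub>N\<^esub> \<zero>\<^bsub>N\<^esub> = \<zero>\<^bsub>N\<^esub>"
    by (rule q1.H.minus_equality) simp_all
  define P where "P = pullback_module E1 q1 E2 q2"
  define D where "D = {(i1 a, \<ominus>\<^bsub>E2\<^esub> i2 a) | a. a \<in> carrier M}"
  have P_abelian: "abelian_group P"
    unfolding P_def by (rule abelian_group_pullback_module) unfold_locales
  interpret P: abelian_group P by (rule P_abelian)
  have P_carrier: "(x, y) \<in> carrier P \<longleftrightarrow> x \<in> carrier E1 \<and> y \<in> carrier E2 \<and> q1 x = q2 y" for x y
    by (simp add: P_def)
  have P_add: "(x, y) \<oplus>\<^bsub>P\<^esub> (x', y') = (x \<oplus>\<^bsub>E1\<^esub> x', y \<oplus>\<^bsub>E2\<^esub> y')" for x y x' y'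
    by (simp add: P_def)
  have P_smult: "s \<odot>\<^bsub>P\<^esub> (x, y) = (s \<odot>\<^bsub>E1\<^esub> x, s \<odot>\<^bsub>E2\<^esub> y)" for s x y
    by (simp add: P_def)
  have D_sub: "D \<subseteq> carrier P"
    by (auto simp: D_def P_carrier)
  have "subgroup D (add_monoid P)"
  proof (rule group.subgroupI[OF P.a_group])
    show "D \<subseteq> carrier (add_monoid P)" using D_sub by simp
    show "D \<noteq> {}" unfolding D_def using M.zero_closed by blast
  next
    fix d assume "d \<in> D"
    then obtain a where a: "a \<in> carrier M" "d = (i1 a, \<ominus>\<^bsub>E2\<^esub> i2 a)" by (auto simp: D_def)
    have "\<ominus>\<^bsub>P\<^esub> d = (i1 (\<ominus>\<^bsub>M\<^esub> a), \<ominus>\<^bsub>E2\<^esub> i2 (\<ominus>\<^bsub>M\<^esub> a))"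
    proof (rule P.minus_equality)
      show "(i1 (\<ominus>\<^bsub>M\<^esub> a), \<ominus>\<^bsub>E2\<^esub> i2 (\<ominus>\<^bsub>M\<^esub> a)) \<oplus>\<^bsub>P\<^esub> d = \<zero>\<^bsub>P\<^esub>"
        using a by (simp add: P_add P_def E1.M.l_neg E2.M.r_neg)
    qed (use a in \<open>auto simp: P_carrier\<close>)
    then have "\<ominus>\<^bsub>P\<^esub> d \<in> D" using a unfolding D_def by blast
    then show "inv\<^bsub>add_monoid P\<^esub> d \<in> D" by (simp add: a_inv_def)
    fix d' assume "d' \<in> D"
    then obtain b where b: "b \<in> carrier M" "d' = (i1 b, \<ominus>\<^bsub>E2\<^esub> i2 b)" by (auto simp: D_def)
    have "d \<oplus>\<^bsub>P\<^esub> d' = (i1 (a \<oplus>\<^bsub>M\<^esub> b), \<ominus>\<^bsub>E2\<^esub> i2 (a \<oplus>\<^bsub>M\<^esub> b))"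
      using a b by (simp add: P_add E2.M.minus_add)
    then have "d \<oplus>\<^bsub>P\<^esub> d' \<in> D" using M.a_closed[OF a(1) b(1)] unfolding D_def by blast
    then show "d \<otimes>\<^bsub>add_monoid P\<^esub> d' \<in> D" by simp
  qed
  then interpret D: abelian_subgroup D P
    by (intro abelian_subgroupI3 additive_subgroupI P_abelian)
  have P_smult_closed: "s \<odot>\<^bsub>P\<^esub> z \<in> carrier P" if "s \<in> carrier S" "z \<in> carrier P" for s z
    using that by (cases z) (simp add: P_carrier P_smult smult_homs)
  have D_smult: "s \<odot>\<^bsub>P\<^esub> d \<in> D" if s: "s \<in> carrier S" and d: "d \<in> D" for s d
  proof -
    obtain a where a: "a \<in> carrier M" "d = (i1 a, \<ominus>\<^bsub>E2\<^esub> i2 a)" using d by (auto simp: D_def)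
    then have "s \<odot>\<^bsub>P\<^esub> d = (i1 (s \<odot>\<^bsub>M\<^esub> a), \<ominus>\<^bsub>E2\<^esub> i2 (s \<odot>\<^bsub>M\<^esub> a))"
      using s by (simp add: P_smult smult_homs E2.smult_r_minus)
    then show ?thesis using M(2)[OF s a(1)] unfolding D_def by blast
  qed
  have P_smult_add: "s \<odot>\<^bsub>P\<^esub> (z \<oplus>\<^bsub>P\<^esub> w) = s \<odot>\<^bsub>P\<^esub> z \<oplus>\<^bsub>P\<^esub> s \<odot>\<^bsub>P\<^esub> w"
    if "s \<in> carrier S" "z \<in> carrier P" "w \<in> carrier P" for s z w
    using that by (cases z; cases w) (simp add: P_carrier P_smult P_add E1.smult_r_distr E2.smult_r_distr)
  have coset_eq: "D +>\<^bsub>P\<^esub> (d \<oplus>\<^bsub>P\<^esub> z) = D +>\<^bsub>P\<^esub> z" if "d \<in> D" "z \<in> carrier P" for d z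
  proof (rule sym, rule P.a_repr_independence[OF _ that(2) D.a_subgroup])
    show "d \<oplus>\<^bsub>P\<^esub> z \<in> D +>\<^bsub>P\<^esub> z" using that(1) unfolding a_r_coset_def' by blast
  qed
  have coset_smult: "s \<odot>\<^bsub>quotient_module P D\<^esub> (D +>\<^bsub>P\<^esub> z) = D +>\<^bsub>P\<^esub> (s \<odot>\<^bsub>P\<^esub> z)"
    if s: "s \<in> carrier S" and z: "z \<in> carrier P" for s z
  proof -
    have "D +>\<^bsub>P\<^esub> (s \<odot>\<^bsub>P\<^esub> u) = D +>\<^bsub>P\<^esub> (s \<odot>\<^bsub>P\<^esub> z)" if u: "u \<in> D +>\<^bsub>P\<^esub> z" for u
    proof -
      obtain d where "d \<in> D" "u = d \<oplus>\<^bsub>P\<^esub> z" using u unfolding a_r_coset_def' by blast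
      then show ?thesis
        using P_smult_add[OF s subsetD[OF D_sub \<open>d \<in> D\<close>] z]
          coset_eq[OF D_smult[OF s \<open>d \<in> D\<close>] P_smult_closed[OF s z]] by simp
    qed
    then show ?thesis
      unfolding quotient_module_simps by (intro UN_constant_eq[OF D.a_rcos_self[OF z]] ballI)
  qed
  have coset_carrier: "D +>\<^bsub>P\<^esub> z \<in> carrier (quotient_module P D)" if "z \<in> carrier P" for z
    using P.a_rcosetsI[OF D_sub that] by simp
  have baer: "baer_sum M (E1, i1, q1) (E2, i2, q2) = (quotient_module P D,
      (\<lambda>a. D +>\<^bsub>P\<^esub> (i1 a, \<zero>\<^bsub>E2\<^esub>)), (\<lambda>C. the_elem ((q1 \<circ> fst) ` C)))"
    by (simp add: baer_sum_def P_def D_def Let_def)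
  have hom: "\<gamma> \<in> module_hom_set S (quotient_module P D) E"
    and gamma_i: "\<And>a. a \<in> carrier M \<Longrightarrow> \<gamma> (D +>\<^bsub>P\<^esub> (i1 a, \<zero>\<^bsub>E2\<^esub>)) = i a"
    and q_gamma: "\<And>C. C \<in> carrier (quotient_module P D) \<Longrightarrow> q (\<gamma> C) = the_elem ((q1 \<circ> fst) ` C)"
    using mor unfolding baer extension_morphism_def by auto
  note gamma = module_hom_setD[OF hom]
  have q_coset: "q (\<gamma> (D +>\<^bsub>P\<^esub> (x, y))) = q1 x" if "(x, y) \<in> carrier P" for x y
  proof -
    have "q1 (fst u) = q1 x" if u: "u \<in> D +>\<^bsub>P\<^esub> (x, y)" for u
    proof -
      obtain a where "a \<in> carrier M" "u = (i1 a, \<ominus>\<^bsub>E2\<^esub> i2 a) \<oplus>\<^bsub>P\<^esub> (x, y)"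
        using u unfolding a_r_coset_def' D_def by blast
      then show ?thesis using \<open>(x, y) \<in> carrier P\<close> by (simp add: P_add P_carrier)
    qed
    then have "(q1 \<circ> fst) ` (D +>\<^bsub>P\<^esub> (x, y)) = (\<lambda>u. q1 x) ` (D +>\<^bsub>P\<^esub> (x, y))"
      by (intro image_cong) simp_all
    also have "\<dots> = {q1 x}" using D.a_rcos_self[OF that] by (intro image_constant)
    finally show ?thesis using q_gamma[OF coset_carrier[OF that]] by simp
  qed
  show ?thesis
  proof (rule that[of "\<lambda>x y. \<gamma> (D +>\<^bsub>P\<^esub> (x, y))"])
    fix x y assume xy: "x \<in> carrier E1" "y \<in> carrier E2" "q1 x = q2 y"
    then have z: "(x, y) \<in> carrier P" by (simp add: P_carrier)
    show "\<gamma> (D +>\<^bsub>P\<^esub> (x, y)) \<in> carrier E \<and> q (\<gamma> (D +>\<^bsub>P\<^esub> (x, y))) = q1 x"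
      using gamma(1)[OF coset_carrier[OF z]] q_coset[OF z] by blast
    show "\<gamma> (D +>\<^bsub>P\<^esub> (s \<odot>\<^bsub>E1\<^esub> x, s \<odot>\<^bsub>E2\<^esub> y)) = s \<odot>\<^bsub>E\<^esub> \<gamma> (D +>\<^bsub>P\<^esub> (x, y))"
      if "s \<in> carrier S" for s
      using gamma(3)[OF that coset_carrier[OF z]] coset_smult[OF that z] by (simp add: P_smult)
    fix x' y' assume "x' \<in> carrier E1" "y' \<in> carrier E2" "q1 x' = q2 y'"
    then have z': "(x', y') \<in> carrier P" by (simp add: P_carrier)
    show "\<gamma> (D +>\<^bsub>P\<^esub> (x \<oplus>\<^bsub>E1\<^esub> x', y \<oplus>\<^bsub>E2\<^esub> y')) = \<gamma> (D +>\<^bsub>P\<^esub> (x, y)) \<oplus>\<^bsub>E\<^esub> \<gamma> (D +>\<^bsub>P\<^esub> (x', y'))"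
      using gamma(2)[OF coset_carrier[OF z] coset_carrier[OF z']] D.a_rcos_sum[OF z z']
      by (simp add: P_add)
  next
    fix a assume a: "a \<in> carrier M"
    show "\<gamma> (D +>\<^bsub>P\<^esub> (i1 a, \<zero>\<^bsub>E2\<^esub>)) = i a" by (rule gamma_i[OF a])
    \<comment> \<open>The pairs \<open>(i1 a, 0)\<close> and \<open>(0, i2 a)\<close> lie in the same coset of the antidiagonal.\<close>
    have "(i1 a, \<zero>\<^bsub>E2\<^esub>) = (i1 a, \<ominus>\<^bsub>E2\<^esub> i2 a) \<oplus>\<^bsub>P\<^esub> (\<zero>\<^bsub>E1\<^esub>, i2 a)"
      using a by (simp add: P_add E2.M.l_neg)
    moreover have "(i1 a, \<ominus>\<^bsub>E2\<^esub> i2 a) \<in> D" using a unfolding D_def by blast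
    ultimately have "D +>\<^bsub>P\<^esub> (i1 a, \<zero>\<^bsub>E2\<^esub>) = D +>\<^bsub>P\<^esub> (\<zero>\<^bsub>E1\<^esub>, i2 a)"
      using coset_eq a by (simp add: P_carrier)
    then show "\<gamma> (D +>\<^bsub>P\<^esub> (\<zero>\<^bsub>E1\<^esub>, i2 a)) = i a" using gamma_i[OF a] by simp
  qed
qed

section \<open>The matrix of the variable on a Baer sum\<close>

lemma vector_axis_induct [case_names zero add axis]:
  fixes x :: "'a::comm_ring_1 ^ 'n"
  assumes "P 0" and "\<And>x y. P x \<Longrightarrow> P y \<Longrightarrow> P (x + y)" and "\<And>c j. P (c *s axis j 1)"
  shows "P x"
proof -
  have "P (\<Sum>j\<in>I. (x $ j) *s axis j 1)" for I
    by (induction I rule: infinite_finite_induct) (simp_all add: assms)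
  then show ?thesis by (metis basis_expansion)
qed

lemma matrix_vector_mult_axis: "B *v axis k 1 = (\<chi> i. (B :: 'a::comm_ring_1 ^ 'n ^ 'm) $ i $ k)"
  by (simp add: vec_eq_iff matrix_vector_mult_def axis_def if_distrib cong: if_cong)

definition basis_combination :: "('r::comm_ring_1 poly, 'e) module \<Rightarrow> ('n::finite \<Rightarrow> 'e) \<Rightarrow> 'r ^ 'n \<Rightarrow> 'e" where
  "basis_combination E e c = (\<Oplus>\<^bsub>E\<^esub>j\<in>UNIV. [:c $ j:] \<odot>\<^bsub>E\<^esub> e j)"

locale poly_module_family = type_module E
  for E :: "('r::comm_ring_1 poly, 'e) module" +
  fixes e :: "'n::finite \<Rightarrow> 'e"
  assumes e_closed [simp]: "e j \<in> carrier E"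
begin

abbreviation "combine \<equiv> basis_combination E e"

lemma combine_closed [simp]: "combine c \<in> carrier E"
  by (simp add: basis_combination_def E.finsum_closed)

lemma combine_add: "combine (c + d) = combine c \<oplus>\<^bsub>E\<^esub> combine d"
proof -
  have "[:(c + d) $ j:] \<odot>\<^bsub>E\<^esub> e j = [:c $ j:] \<odot>\<^bsub>E\<^esub> e j \<oplus>\<^bsub>E\<^esub> [:d $ j:] \<odot>\<^bsub>E\<^esub> e j" for j
    using smult_add_left[of "e j" "[:c $ j:]" "[:d $ j:]"] by simp
  then show ?thesis
    unfolding basis_combination_def by (simp add: E.finsum_addf)
qed

lemma combine_const: "combine (a *s c) = [:a:] \<odot>\<^bsub>E\<^esub> combine c"
proof -
  have "[:(a *s c) $ j:] \<odot>\<^bsub>E\<^esub> e j = [:a:] \<odot>\<^bsub>E\<^esub> ([:c $ j:] \<odot>\<^bsub>E\<^esub> e j)" for j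
    by (simp add: smult_smult mult.commute)
  then show ?thesis
    unfolding basis_combination_def by (simp add: finsum_smult)
qed

lemma combine_axis: "combine (axis j 1) = e j"
proof -
  have "[:axis j 1 $ l:] \<odot>\<^bsub>E\<^esub> e l = (if j = l then e l else \<zero>\<^bsub>E\<^esub>)" for l
    by (simp add: axis_def one_pCons[symmetric])
  then show ?thesis
    unfolding basis_combination_def by (simp add: E.finsum_singleton)
qed

lemma combine_zero [simp]: "combine 0 = \<zero>\<^bsub>E\<^esub>"
  using combine_const[of 0 0] by simp

text \<open>For a basis, this says that linear combination is an isomorphism onto \<open>E\<close> from the matrix
  module of \<open>B\<close>.\<close>

lemma combine_var:
  assumes "variable_matrix E e B"
  shows "[:0, 1:] \<odot>\<^bsub>E\<^esub> combine c = combine (B *v c)"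
proof (induction c rule: vector_axis_induct)
  case zero
  then show ?case by simp
next
  case (add c d)
  then show ?case by (simp add: combine_add smult_add_right matrix_vector_right_distrib)
next
  case (axis a j)
  have "[:0, 1:] \<odot>\<^bsub>E\<^esub> e j = combine (B *v axis j 1)"
    using assms by (simp add: variable_matrix_def basis_combination_def matrix_vector_mult_axis)
  moreover have "[:0, 1:] \<odot>\<^bsub>E\<^esub> ([:a:] \<odot>\<^bsub>E\<^esub> e j) = [:a:] \<odot>\<^bsub>E\<^esub> ([:0, 1:] \<odot>\<^bsub>E\<^esub> e j)"
    by (simp add: smult_smult)
  ultimately show ?case
    by (simp add: combine_const combine_axis matrix_vector_mult_smult)
qed

end

lemma restrict_scalars_simps [simp]:
  "carrier (restrict_scalars r M) = carrier M"
  "x \<oplus>\<^bsub>restrict_scalars r M\<^esub> y = x \<oplus>\<^bsub>M\<^esub> y"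
  "\<zero>\<^bsub>restrict_scalars r M\<^esub> = \<zero>\<^bsub>M\<^esub>"
  "s \<odot>\<^bsub>restrict_scalars r M\<^esub> x = map_poly r s \<odot>\<^bsub>M\<^esub> x"
  by (simp_all add: restrict_scalars_def)

lemma abelian_group_restrict_scalars:
  assumes "abelian_group M"
  shows "abelian_group (restrict_scalars r M)"
proof -
  interpret M: abelian_group M by fact
  show ?thesis
  proof (rule abelian_groupI)
    fix x assume "x \<in> carrier (restrict_scalars r M)"
    then show "\<exists>y\<in>carrier (restrict_scalars r M).
        y \<oplus>\<^bsub>restrict_scalars r M\<^esub> x = \<zero>\<^bsub>restrict_scalars r M\<^esub>"
      by (intro bexI[of _ "\<ominus>\<^bsub>M\<^esub> x"]) (simp_all add: M.l_neg)
  qed (auto simp: M.a_assoc intro: M.a_comm)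
qed

context length_two_reduction
begin

lemma red_poly_const [simp]: "map_poly r [:c:] = [:r c:]"
  by (simp add: map_poly_pCons)

lemma red_poly_var [simp]: "map_poly r [:0, 1:] = [:0, 1:]"
  by (simp add: map_poly_pCons red_one)

end

text \<open>The situation obtained from a Baer sum \<open>E\<close> of \<open>F\<close> and of the extension attached to the lift
  \<open>A0\<close>, seen through the map \<open>\<psi>\<close> on the pullback of \<open>F\<close> and the free module. As \<open>F\<close> is a module
  over the polynomial ring of the residue field, scalars act on its elements through their residues.\<close>

locale lift_comparison = length_two_reduction \<pi> r + matrix_extension A F j p
  for \<pi> :: "'r::comm_ring_1" and r :: "'r \<Rightarrow> 'k::field"
    and A :: "'k ^ 'n ^ 'n" and F :: "('k poly, 'f) module" and j p +
  fixes A0 :: "'r ^ 'n ^ 'n" and E :: "('r poly, 'e) module" and i :: "'k ^ 'n \<Rightarrow> 'e"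
    and q :: "'e \<Rightarrow> 'k ^ 'n" and \<psi> :: "'f \<Rightarrow> 'r ^ 'n \<Rightarrow> 'e"
  assumes red_A0: "map_matrix r A0 = A"
    and ext_E: "is_extension ring_of_type_algebra
      (restrict_scalars r (matrix_module A)) (restrict_scalars r (matrix_module A)) (E, i, q)"
    and psi_closed: "f \<in> carrier F \<Longrightarrow> p f = map_vector r y \<Longrightarrow> \<psi> f y \<in> carrier E"
    and q_psi: "f \<in> carrier F \<Longrightarrow> p f = map_vector r y \<Longrightarrow> q (\<psi> f y) = p f"
    and psi_add: "f \<in> carrier F \<Longrightarrow> p f = map_vector r y \<Longrightarrow> f' \<in> carrier F \<Longrightarrow> p f' = map_vector r y' \<Longrightarrow>
      \<psi> (f \<oplus>\<^bsub>F\<^esub> f') (y + y') = \<psi> f y \<oplus>\<^bsub>E\<^esub> \<psi> f' y'"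
    and psi_const: "f \<in> carrier F \<Longrightarrow> p f = map_vector r y \<Longrightarrow>
      \<psi> ([:r c:] \<odot>\<^bsub>F\<^esub> f) (c *s y) = [:c:] \<odot>\<^bsub>E\<^esub> \<psi> f y"
    and psi_var: "f \<in> carrier F \<Longrightarrow> p f = map_vector r y \<Longrightarrow>
      \<psi> ([:0, 1:] \<odot>\<^bsub>F\<^esub> f) (A0 *v y) = [:0, 1:] \<odot>\<^bsub>E\<^esub> \<psi> f y"
    and psi_left: "\<psi> (j a) 0 = i a"
    and psi_right: "\<psi> \<zero>\<^bsub>F\<^esub> (\<pi> *s y) = i (map_vector r y)"
begin

sublocale E: type_module E
  by (rule type_module.intro[OF is_extensionD(1)[OF ext_E]])

lemmas hom_i = module_hom_setD[OF is_extensionD(3)[OF ext_E], simplified]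
lemmas hom_q = module_hom_setD[OF is_extensionD(4)[OF ext_E], simplified]

lemma i_eq_zero_iff: "i a = \<zero>\<^bsub>E\<^esub> \<longleftrightarrow> a = 0"
proof -
  have "i 0 \<oplus>\<^bsub>E\<^esub> i 0 = i 0" using hom_i(2)[of 0 0] by simp
  then have "i 0 = \<zero>\<^bsub>E\<^esub>" using E.E.add.l_cancel_one[of "i 0" "i 0"] by (simp add: hom_i(1))
  then show ?thesis using is_extensionD(5)[OF ext_E] by (metis UNIV_I inj_onD matrix_module_simps(1) restrict_scalars_simps(1))
qed

lemma psi_left_translate:
  assumes "f \<in> carrier F" "p f = map_vector r y"
  shows "\<psi> (j a \<oplus>\<^bsub>F\<^esub> f) y = i a \<oplus>\<^bsub>E\<^esub> \<psi> f y"
proof -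
  have "p (j a) = map_vector r 0" by (simp add: vec_eq_iff)
  then show ?thesis using psi_add[of "j a" 0 f y] assms by (simp add: hom_j(1) psi_left)
qed

text \<open>For fixed \<open>y\<close>, the map \<open>\<psi>\<close> is a bijection between the fibres of \<open>F\<close> and \<open>E\<close> over the residue of
  \<open>y\<close>, because both are torsors under \<open>M\<^sup>A\<close> and \<open>\<psi>\<close> respects the translations.\<close>

lemma psi_inject:
  assumes f: "f \<in> carrier F" "p f = map_vector r y" and f': "f' \<in> carrier F" "p f' = map_vector r y"
    and eq: "\<psi> f y = \<psi> f' y"
  shows "f = f'"
proof -
  obtain a where a: "f = j a \<oplus>\<^bsub>F\<^esub> f'" using fibre[of f f'] f f' by auto
  then have "i a \<oplus>\<^bsub>E\<^esub> \<psi> f' y = \<psi> f' y" using psi_left_translate[OF f', of a] eq by simp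
  then have "i a = \<zero>\<^bsub>E\<^esub>"
    using E.E.add.l_cancel_one[of "\<psi> f' y" "i a"] psi_closed[OF f'] by (simp add: hom_i(1))
  then have "j a = \<zero>\<^bsub>F\<^esub>"
    using j_const[of 0 0] by (simp add: i_eq_zero_iff hom_j(1))
  then show ?thesis using a f' by simp
qed

lemma psi_surj:
  assumes "z \<in> carrier E" "q z = map_vector r y"
  obtains f where "f \<in> carrier F" "p f = map_vector r y" "\<psi> f y = z"
proof -
  have "map_vector r y \<in> p ` carrier F" using is_extensionD(7)[OF ext] by simp
  then obtain f where f: "f \<in> carrier F" "p f = map_vector r y" by auto
  have "abelian_group (restrict_scalars r (matrix_module A))"
    by (rule abelian_group_restrict_scalars[OF abelian_group_matrix_module])
  then obtain a where "z = i a \<oplus>\<^bsub>E\<^esub> \<psi> f y"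
    using extension_fibre[OF ext_E _ assms(1) psi_closed[OF f]] assms(2) f q_psi[OF f] by metis
  then have "\<psi> (j a \<oplus>\<^bsub>F\<^esub> f) y = z" using psi_left_translate[OF f] by simp
  moreover have "p (j a \<oplus>\<^bsub>F\<^esub> f) = map_vector r y" using f by (simp add: hom_p hom_j(1))
  ultimately show ?thesis using that[of "j a \<oplus>\<^bsub>F\<^esub> f"] f by (simp add: hom_j(1))
qed

text \<open>Let \<open>\<epsilon>\<close> send a vector to the linear combination of the basis with these coefficients. For each
  vector \<open>y\<close> there is a unique \<open>\<sigma> y\<close> in the fibre of \<open>F\<close> over its residue with \<open>\<psi> (\<sigma> y) y = \<epsilon> y\<close>, and uniqueness makes \<open>\<sigma>\<close>
  linear. It vanishes on multiples of \<open>\<pi>\<close>, which acts as zero on \<open>F\<close>, and therefore descends to a section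
  \<open>s\<close> over the residue field. Applying the variable to \<open>\<epsilon> y = \<psi> (s (r y)) y\<close> acts on the first
  argument through \<open>A\<close> and the matrix of \<open>s\<close> and on the second one through \<open>A0\<close>; the contribution of
  the matrix of \<open>s\<close> lands in the submodule, which is \<open>\<pi> E\<close>.\<close>

lemma variable_matrix_perturbation:
  assumes basis: "coefficient_basis E e" and q_e: "\<And>l. q (e l) = axis l 1"
    and B: "variable_matrix E e B"
  obtains s C where "sectioned_matrix_extension A F j p s"
    "\<And>x. [:0, 1:] \<odot>\<^bsub>F\<^esub> s x = j (map_matrix r C *v x) \<oplus>\<^bsub>F\<^esub> s (A *v x)"
    "B = A0 + map_matrix ((*) \<pi>) C"
proof -
  have "e l \<in> carrier E" for l
    using basis by (auto simp: coefficient_basis_def)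
  then interpret e: poly_module_family E e
    by unfold_locales
  have bij: "bij_betw e.combine UNIV (carrier E)"
    using basis by (simp add: coefficient_basis_def basis_combination_def[abs_def])
  have q_combine: "q (e.combine y) = map_vector r y" for y
  proof (induction y rule: vector_axis_induct)
    case zero
    have "q (\<zero>\<^bsub>E\<^esub> \<oplus>\<^bsub>E\<^esub> \<zero>\<^bsub>E\<^esub>) = q \<zero>\<^bsub>E\<^esub> + q \<zero>\<^bsub>E\<^esub>" by (rule hom_q(2)) simp_all
    then have "q \<zero>\<^bsub>E\<^esub> = q \<zero>\<^bsub>E\<^esub> + q \<zero>\<^bsub>E\<^esub>" by simp
    then have "q \<zero>\<^bsub>E\<^esub> = 0" by (simp only: add_cancel_right_right)
    then show ?case by (simp add: vec_eq_iff)
  next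
    case (add x y)
    then show ?case by (simp add: e.combine_add hom_q red_vector_add)
  next
    case (axis c l)
    have "map_vector r (axis l 1) = axis l 1" by (simp add: vec_eq_iff axis_def red_one)
    then show ?case
      by (simp add: e.combine_const e.combine_axis hom_q q_e red_vector_smult)
  qed
  have "\<exists>f. f \<in> carrier F \<and> p f = map_vector r y \<and> \<psi> f y = e.combine y" for y
    using psi_surj[OF e.combine_closed q_combine] by metis
  then obtain \<sigma> where \<sigma>: "\<And>y. \<sigma> y \<in> carrier F" "\<And>y. p (\<sigma> y) = map_vector r y"
    "\<And>y. \<psi> (\<sigma> y) y = e.combine y"
    by metis
  have sigma_add: "\<sigma> (x + y) = \<sigma> x \<oplus>\<^bsub>F\<^esub> \<sigma> y" for x y
    by (rule psi_inject[of _ "x + y"])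
      (simp_all add: \<sigma> hom_p red_vector_add psi_add e.combine_add)
  have sigma_const: "\<sigma> (c *s y) = [:r c:] \<odot>\<^bsub>F\<^esub> \<sigma> y" for c y
    by (rule psi_inject[of _ "c *s y"])
      (simp_all add: \<sigma> p_const red_vector_smult psi_const e.combine_const)
  have sigma_pi: "\<sigma> (\<pi> *s y) = \<zero>\<^bsub>F\<^esub>" for y
    by (simp add: sigma_const \<sigma>)
  have combine_pi: "e.combine (\<pi> *s y) = i (map_vector r y)" for y
    using \<sigma>(3)[of "\<pi> *s y"] by (simp add: sigma_pi psi_right)
  have sigma_red: "\<sigma> x = \<sigma> y" if "map_vector r x = map_vector r y" for x y
    using red_vector_eqE[OF that] by (metis sigma_add sigma_pi \<sigma>(1) F.E.r_zero)
  \<comment> \<open>The choice of the lift is irrelevant by the preceding fact.\<close>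
  define s where "s x = \<sigma> (map_vector (inv_into UNIV r) x)" for x
  have s_red: "s (map_vector r y) = \<sigma> y" for y
    unfolding s_def by (rule sigma_red) (simp add: vec_eq_iff surj_f_inv_f[OF red_surj])
  have sect: "sectioned_matrix_extension A F j p s"
  proof
    fix x y :: "'k ^ 'n" and c :: 'k
    obtain x' where x': "x = map_vector r x'" using red_vector_surj by metis
    obtain y' where y': "y = map_vector r y'" using red_vector_surj by metis
    obtain c' where c': "c = r c'" using red_surj by (metis surjD)
    show "s x \<in> carrier F" "p (s x) = x" by (simp_all add: x' s_red \<sigma>)
    show "s (x + y) = s x \<oplus>\<^bsub>F\<^esub> s y"
      by (simp add: x' y' s_red sigma_add flip: red_vector_add)
    show "s (c *s x) = [:c:] \<odot>\<^bsub>F\<^esub> s x"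
      by (simp add: x' c' s_red sigma_const flip: red_vector_smult)
  qed
  interpret s: sectioned_matrix_extension A F j p s by (rule sect)
  obtain C where C: "\<And>x. [:0, 1:] \<odot>\<^bsub>F\<^esub> s x = j (C *v x) \<oplus>\<^bsub>F\<^esub> s (A *v x)"
    using s.var_section by blast
  obtain C' where C': "map_matrix r C' = C" by (rule red_matrix_surj)
  have "B *v y = (A0 + map_matrix ((*) \<pi>) C') *v y" for y
  proof -
    have A0y: "map_vector r (A0 *v y) = A *v map_vector r y"
      by (simp add: red_vector_mult red_A0)
    have "e.combine (B *v y) = [:0, 1:] \<odot>\<^bsub>E\<^esub> \<psi> (\<sigma> y) y"
      by (simp add: e.combine_var[OF B] \<sigma>)
    also have "\<dots> = \<psi> ([:0, 1:] \<odot>\<^bsub>F\<^esub> s (map_vector r y)) (A0 *v y)"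
      by (simp add: psi_var \<sigma> s_red)
    also have "\<dots> = \<psi> (j (C *v map_vector r y) \<oplus>\<^bsub>F\<^esub> \<sigma> (A0 *v y)) (A0 *v y)"
      using C[of "map_vector r y"] by (simp only: s_red[of "A0 *v y"] flip: A0y)
    also have "\<dots> = i (map_vector r (C' *v y)) \<oplus>\<^bsub>E\<^esub> e.combine (A0 *v y)"
      by (simp add: psi_left_translate \<sigma> red_vector_mult C')
    also have "\<dots> = e.combine ((A0 + map_matrix ((*) \<pi>) C') *v y)"
      by (simp add: matrix_vector_mult_add_rdistrib map_matrix_smult_vector e.combine_add combine_pi
          E.E.a_comm hom_i(1))
    finally show ?thesis using bij by (auto simp: bij_betw_def dest: injD)
  qed
  then have "B = A0 + map_matrix ((*) \<pi>) C'" by (simp add: matrix_eq)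
  with that[of s C'] sect C C' show ?thesis by simp
qed

end

section \<open>Stabilizers as reductions of centralizers\<close>

text \<open>An element of the sum of two classes comes from a Baer sum of representatives. Composing with
  the equivalences to these representatives replaces them by a member \<open>F\<close> of \<open>\<xi>\<close> itself and by the
  matrix module of \<open>A0\<close>.\<close>

lemma (in length_two_reduction) Ext1_add_lift_class_comparison:
  fixes \<xi> :: "('k poly, 'k ^ 'n, 'e, 'k ^ 'n) extn set"
  assumes A0: "map_matrix r A0 = A"
    and \<xi>: "\<xi> \<in> Ext1 ring_of_type_algebra (matrix_module A) (matrix_module A)"
    and E: "(E, i, q) \<in> Ext1_add ring_of_type_algebra
           (restrict_scalars r (matrix_module A)) (restrict_scalars r (matrix_module A))
           (Ext1_restrict r (matrix_module A) (matrix_module A) \<xi>) (lift_class \<pi> r A A0)"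
  obtains F j p \<psi> where "(F, j, p) \<in> \<xi>" "lift_comparison \<pi> r A F j p A0 E i q \<psi>"
proof -
  let ?S = "ring_of_type_algebra :: 'r poly ring"
  let ?M = "restrict_scalars r (matrix_module A)"
  have M: "abelian_group ?M"
    by (rule abelian_group_restrict_scalars[OF abelian_group_matrix_module])
  obtain E1 E2 :: "('r poly, 'e) module" and i1 q1 i2 q2 where
      1: "(E1, i1, q1) \<in> Ext1_restrict r (matrix_module A) (matrix_module A) \<xi>"
    and 2: "(E2, i2, q2) \<in> lift_class \<pi> r A A0"
    and 3: "(E, i, q) \<in> extension_class ?S ?M ?M (baer_sum ?M (E1, i1, q1) (E2, i2, q2))"
    using E by (auto simp: Ext1_add_def)
  obtain F j p where F: "(F, j, p) \<in> \<xi>"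
    and E1: "(E1, i1, q1) \<in> extension_class ?S ?M ?M (restrict_scalars r F, j, p)"
    using 1 by (auto simp: Ext1_restrict_def)
  have ext1: "is_extension ?S ?M ?M (E1, i1, q1)" and ext2: "is_extension ?S ?M ?M (E2, i2, q2)"
    and ext: "is_extension ?S ?M ?M (E, i, q)"
    using E1 2 3 by (simp_all add: extension_class_def lift_class_def)
  obtain \<alpha> where \<alpha>: "extension_morphism ?S ?M (\<lambda>a. a) (\<lambda>b. b) (restrict_scalars r F, j, p) (E1, i1, q1) \<alpha>"
    using E1 by (auto simp: extension_class_def extension_equiv_def)
  obtain \<beta> where \<beta>: "extension_morphism ?S ?M (\<lambda>a. a) (\<lambda>b. b) (lift_extension \<pi> r A0) (E2, i2, q2) \<beta>"
    using 2 by (auto simp: lift_class_def extension_class_def extension_equiv_def)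
  obtain \<gamma> where \<gamma>: "extension_morphism ?S ?M (\<lambda>a. a) (\<lambda>b. b)
      (baer_sum ?M (E1, i1, q1) (E2, i2, q2)) (E, i, q) \<gamma>"
    using 3 by (auto simp: extension_class_def extension_equiv_def)
  interpret F: matrix_extension A F j p
    by (rule matrix_extension.intro[OF Ext1_eq_extension_class(1)
          [OF abelian_group_matrix_module abelian_group_matrix_module \<xi> F]])
  have \<alpha>_hom: "\<alpha> \<in> module_hom_set ?S (restrict_scalars r F) E1"
    and \<alpha>_j: "\<And>a. \<alpha> (j a) = i1 a" and q1_\<alpha>: "\<And>f. f \<in> carrier F \<Longrightarrow> q1 (\<alpha> f) = p f"
    using \<alpha> by (auto simp: extension_morphism_def)
  have \<beta>_hom: "\<beta> \<in> module_hom_set ?S (matrix_module A0) E2"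
    and \<beta>_lift: "\<And>a. \<beta> (\<pi> *s (SOME y. map_vector r y = a)) = i2 a"
    and q2_\<beta>: "\<And>y. q2 (\<beta> y) = map_vector r y"
    using \<beta> by (auto simp: extension_morphism_def lift_extension_def map_vector_def)
  \<comment> \<open>The inclusion into the matrix module of \<open>A0\<close> is independent of the chosen lift.\<close>
  have \<beta>_pi: "\<beta> (\<pi> *s y) = i2 (map_vector r y)" for y
  proof -
    have "map_vector r (SOME z. map_vector r z = map_vector r y) = map_vector r y"
      by (rule someI) (rule refl)
    then show ?thesis
      using \<beta>_lift[of "map_vector r y"] pi_vector_cancel by metis
  qed
  note \<alpha>_simps = module_hom_setD[OF \<alpha>_hom, simplified] and \<beta>_simps = module_hom_setD[OF \<beta>_hom, simplified]
  interpret \<alpha>: abelian_group_hom "restrict_scalars r F" E1 \<alpha>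
    by (rule module_hom_abelian_group_hom[OF abelian_group_restrict_scalars is_extensionD(2)[OF ext1] \<alpha>_hom])
      unfold_locales
  interpret \<beta>: abelian_group_hom "matrix_module A0" E2 \<beta>
    by (rule module_hom_abelian_group_hom[OF abelian_group_matrix_module is_extensionD(2)[OF ext2] \<beta>_hom])
  have zero: "\<alpha> \<zero>\<^bsub>F\<^esub> = \<zero>\<^bsub>E1\<^esub>" "\<beta> 0 = \<zero>\<^bsub>E2\<^esub>"
    using \<alpha>.hom_zero \<beta>.hom_zero by simp_all
  have scalar:
    "\<alpha> ([:r c:] \<odot>\<^bsub>F\<^esub> f) = [:c:] \<odot>\<^bsub>E1\<^esub> \<alpha> f" "\<alpha> ([:0, 1:] \<odot>\<^bsub>F\<^esub> f) = [:0, 1:] \<odot>\<^bsub>E1\<^esub> \<alpha> f"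
    "\<beta> (c *s y) = [:c:] \<odot>\<^bsub>E2\<^esub> \<beta> y" "\<beta> (A0 *v y) = [:0, 1:] \<odot>\<^bsub>E2\<^esub> \<beta> y"
    if "f \<in> carrier F" for c f y
    using \<alpha>_simps(3)[OF that, of "[:c:]"] \<alpha>_simps(3)[OF that, of "[:0, 1:]"]
      \<beta>_simps(3)[of "[:c:]" y] \<beta>_simps(3)[of "[:0, 1:]" y] by simp_all
  show ?thesis
  proof (rule baer_sum_universal[OF M _ M ext1 ext2 \<gamma>])
    show "s \<odot>\<^bsub>?M\<^esub> a \<in> carrier ?M" for s a by simp
    fix \<psi>
    assume \<psi>:
      "\<And>x y. x \<in> carrier E1 \<Longrightarrow> y \<in> carrier E2 \<Longrightarrow> q1 x = q2 y \<Longrightarrow> \<psi> x y \<in> carrier E \<and> q (\<psi> x y) = q1 x"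
      "\<And>x y x' y'. x \<in> carrier E1 \<Longrightarrow> y \<in> carrier E2 \<Longrightarrow> q1 x = q2 y \<Longrightarrow>
         x' \<in> carrier E1 \<Longrightarrow> y' \<in> carrier E2 \<Longrightarrow> q1 x' = q2 y' \<Longrightarrow>
         \<psi> (x \<oplus>\<^bsub>E1\<^esub> x') (y \<oplus>\<^bsub>E2\<^esub> y') = \<psi> x y \<oplus>\<^bsub>E\<^esub> \<psi> x' y'"
      "\<And>s x y. s \<in> carrier ?S \<Longrightarrow> x \<in> carrier E1 \<Longrightarrow> y \<in> carrier E2 \<Longrightarrow> q1 x = q2 y \<Longrightarrow>
         \<psi> (s \<odot>\<^bsub>E1\<^esub> x) (s \<odot>\<^bsub>E2\<^esub> y) = s \<odot>\<^bsub>E\<^esub> \<psi> x y"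
      "\<And>a. a \<in> carrier ?M \<Longrightarrow> \<psi> (i1 a) \<zero>\<^bsub>E2\<^esub> = i a"
      "\<And>a. a \<in> carrier ?M \<Longrightarrow> \<psi> \<zero>\<^bsub>E1\<^esub> (i2 a) = i a"
    have "lift_comparison \<pi> r A F j p A0 E i q (\<lambda>f y. \<psi> (\<alpha> f) (\<beta> y))"
    proof (intro lift_comparison.intro lift_comparison_axioms.intro)
      show "length_two_reduction \<pi> r" "matrix_extension A F j p" by unfold_locales
      show "map_matrix r A0 = A" by (rule A0)
      show "is_extension ?S ?M ?M (E, i, q)" by (rule ext)
      show "\<psi> (\<alpha> (j a)) (\<beta> 0) = i a" for a by (simp add: \<alpha>_j zero \<psi>)
      show "\<psi> (\<alpha> \<zero>\<^bsub>F\<^esub>) (\<beta> (\<pi> *s y)) = i (map_vector r y)" for y by (simp add: \<beta>_pi zero \<psi>)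
      fix f y assume f: "f \<in> carrier F" "p f = map_vector r y"
      then have fy: "\<alpha> f \<in> carrier E1" "\<beta> y \<in> carrier E2" "q1 (\<alpha> f) = q2 (\<beta> y)"
        by (simp_all add: \<alpha>_simps \<beta>_simps q1_\<alpha> q2_\<beta>)
      show "\<psi> (\<alpha> f) (\<beta> y) \<in> carrier E" "q (\<psi> (\<alpha> f) (\<beta> y)) = p f"
        using \<psi>(1)[OF fy] f q1_\<alpha> by simp_all
      show "\<psi> (\<alpha> ([:r c:] \<odot>\<^bsub>F\<^esub> f)) (\<beta> (c *s y)) = [:c:] \<odot>\<^bsub>E\<^esub> \<psi> (\<alpha> f) (\<beta> y)" for c
        using \<psi>(3)[OF _ fy] f by (simp add: scalar)
      show "\<psi> (\<alpha> ([:0, 1:] \<odot>\<^bsub>F\<^esub> f)) (\<beta> (A0 *v y)) = [:0, 1:] \<odot>\<^bsub>E\<^esub> \<psi> (\<alpha> f) (\<beta> y)"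
        using \<psi>(3)[OF _ fy] f by (simp add: scalar)
      fix f' y' assume f': "f' \<in> carrier F" "p f' = map_vector r y'"
      then have fy': "\<alpha> f' \<in> carrier E1" "\<beta> y' \<in> carrier E2" "q1 (\<alpha> f') = q2 (\<beta> y')"
        by (simp_all add: \<alpha>_simps \<beta>_simps q1_\<alpha> q2_\<beta>)
      show "\<psi> (\<alpha> (f \<oplus>\<^bsub>F\<^esub> f')) (\<beta> (y + y')) = \<psi> (\<alpha> f) (\<beta> y) \<oplus>\<^bsub>E\<^esub> \<psi> (\<alpha> f') (\<beta> y')"
        using \<psi>(2)[OF fy fy'] f(1) f'(1) by (simp add: \<alpha>_simps \<beta>_simps)
    qed
    with F that show ?thesis by blast
  qed
qed

theorem theorem3p2:
  fixes \<pi> :: "'r::comm_ring_1"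
    and r :: "'r \<Rightarrow> 'k::field"
    and A :: "'k ^ 'n ^ 'n"
    and A0 A\<xi> :: "'r ^ 'n ^ 'n"
    and \<xi> :: "('k poly, 'k ^ 'n, 'e, 'k ^ 'n) extn set"
    and E :: "('r poly, 'e) module"
    and e :: "'n \<Rightarrow> 'e"
  assumes "local_pir_length_two \<pi>"
    and "residue_map \<pi> r"
    and "map_matrix r A0 = A"
    and "\<forall>B. B ** A = A ** B \<longrightarrow> (\<exists>B'. map_matrix r B' = B \<and> B' ** A0 = A0 ** B')"
    and "\<xi> \<in> Ext1 ring_of_type_algebra (matrix_module A) (matrix_module A)"
    and "(E, i, q) \<in> Ext1_add ring_of_type_algebra
           (restrict_scalars r (matrix_module A)) (restrict_scalars r (matrix_module A))
           (Ext1_restrict r (matrix_module A) (matrix_module A) \<xi>) (lift_class \<pi> r A A0)"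
    and "coefficient_basis E e"
    and "\<forall>j. q (e j) = axis j 1"
    and "variable_matrix E e A\<xi>"
  shows "map_matrix r ` GL_centralizer A\<xi> =
    {g \<in> GL_centralizer A. Ext1_act ring_of_type_algebra (matrix_module A) ((*v) g) \<xi> = \<xi>}"
proof -
  interpret length_two_reduction \<pi> r
    by (rule length_two_reductionI[OF assms(1,2)])
  obtain F j p \<psi> where F: "(F, j, p) \<in> \<xi>" and "lift_comparison \<pi> r A F j p A0 E i q \<psi>"
    by (rule Ext1_add_lift_class_comparison[OF assms(3,5,6)])
  then interpret lift_comparison \<pi> r A F j p A0 E i q \<psi> by blast
  obtain s C where s: "sectioned_matrix_extension A F j p s"
    and C: "\<And>x. [:0, 1:] \<odot>\<^bsub>F\<^esub> s x = j (map_matrix r C *v x) \<oplus>\<^bsub>F\<^esub> s (A *v x)"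
    and A\<xi>: "A\<xi> = A0 + map_matrix ((*) \<pi>) C"
    using variable_matrix_perturbation[OF assms(7) _ assms(9)] assms(8) by metis
  interpret s: sectioned_matrix_extension A F j p s by (rule s)
  have stabilizer: "Ext1_act ring_of_type_algebra (matrix_module A) ((*v) g) \<xi> = \<xi> \<longleftrightarrow>
      (\<exists>Y. g ** map_matrix r C + Y ** A = A ** Y + map_matrix r C ** g)"
    if "g \<in> GL_centralizer A" for g
  proof -
    have comm: "g ** A = A ** g" and "invertible g" using that by (auto simp: GL_centralizer_def)
    then obtain h where h: "g ** h = mat 1" "h ** g = mat 1" by (auto simp: invertible_def)
    have "Ext1_act ring_of_type_algebra (matrix_module A) ((*v) g) \<xi> = \<xi> \<longleftrightarrow>
        (\<exists>\<phi>. extension_morphism ring_of_type_algebra (matrix_module A) ((*v) g) ((*v) g) (F, j, p) (F, j, p) \<phi>)"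
      by (rule Ext1_act_fixes_iff[OF abelian_group_matrix_module assms(5) F, where g' = "(*v) h"])
        (simp_all add: matrix_vector_mul_assoc h)
    then show ?thesis using s.self_morphism_iff[OF C comm] by blast
  qed
  have "map_matrix r ` GL_centralizer A\<xi> = {g \<in> GL_centralizer A.
      \<exists>Y. g ** map_matrix r C + Y ** A = A ** Y + map_matrix r C ** g}"
    using red_GL_centralizer[of A0 C] assms(4) by (simp add: A\<xi> assms(3))
  then show ?thesis using stabilizer by blast
qed

end
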